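(* Let $k$ be a field, $\mathcal{O}$ a commutative ring, $V\in\mathbf{CAG}_{\mathcal{O}}(k)$, $\mathcal{I}\in\mathbf{FMod}_{\mathcal{O}}(k)$, $n$ a positive integer and $\ell$ a prime. Then there are $G_k$-equivariant isomorphisms (with $\gamma\in G_k$ acting on the right-hand sides as $\gamma^{-1}\otimes\gamma$), functorial in $\mathcal{I}$ and $V$: (i) $(\mathcal{I}\otimes_{\mathcal{O}}V)(k^s)\cong\mathcal{I}\otimes_{\mathcal{O}}(V(k^s))$; (ii) $(\mathcal{I}\otimes_{\mathcal{O}}V)[n]\cong\mathcal{I}\otimes_{\mathcal{O}}(V[n])$; (iii) $T_\ell(\mathcal{I}\otimes_{\mathcal{O}}V)\cong\mathcal{I}\otimes_{\mathcal{O}}(T_\ell(V))$.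
   Context: Let $k^s$ be a separable closure of $k$ and $G_k=\mathrm{Gal}(k^s/k)$. Rings have identity. "Commutative algebraic group" means commutative algebraic group variety, not necessarily connected. $\mathbf{FMod}_{\mathcal{O}}(k)$: objects are finitely generated free $\mathcal{O}$-modules with a continuous (i.e. factoring through the Galois group of a finite extension of $k$) $\mathcal{O}$-linear right action of $G_k$; morphisms are $G_k$-equivariant $\mathcal{O}$-module homomorphisms. $\mathbf{CAG}_{\mathcal{O}}(k)$: objects are commutative algebraic groups $V$ over $k$ with a ring homomorphism $\mathcal{O}\to\mathrm{End}_k(V)$; morphisms are $\mathcal{O}$-equivariant homomorphisms defined over $k$. Definition of $\mathcal{I}\otimes_{\mathcal{O}}V$: let $d=\mathrm{rank}_{\mathcal{O}}(\mathcal{I})$ and fix an $\mathcal{O}$-module isomorphism $j:\mathcal{O}^d\to\mathcal{I}$. For $\gamma\in G_k$ let $j^\gamma(x)=j(x)\gamma^{-1}$. Let $c_{\mathcal{I}}$ be the image of the cocycle $\gamma\mapsto j^{-1}\circ j^\gamma\in\mathrm{GL}_d(\mathcal{O})$ in $\mathrm{Aut}_{k^s}(V^d)$ (via the action of $\mathrm{GL}_d(\mathcal{O})$ on $V^d$). Then $(\mathcal{I}\otimes_{\mathcal{O}}V,\phi)$ is the pair, unique up to isomorphism, with $\mathcal{I}\otimes_{\mathcal{O}}V\in\mathbf{CAG}_{\mathcal{O}}(k)$ and $\phi:V^d\to\mathcal{I}\otimes_{\mathcal{O}}V$ an isomorphism over $k^s$ such that $c_{\mathcal{I}}(\gamma)=\phi^{-1}\circ\phi^\gamma$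 for all $\gamma\in G_k$. It is independent of $j$ and functorial in $\mathcal{I}$ and $V$. For a commutative algebraic group $W$ over $k$, $W[n]$ denotes the $G_k$-module of elements of $W(k^s)$ of order dividing $n$, and $T_\ell(W)=\varprojlim_m W[\ell^m]$ (transition maps multiplication by $\ell$). *)

theory Defs
  imports "HOL-Algebra.Algebraic_Closure" "HOL-Algebra.Free_Abelian_Groups"
    "HOL-Algebra.Module" "HOL-Algebra.Bij" "HOL-Computational_Algebra.Primes"
begin

section \<open>The base field, its separable closure and the Galois group\<close>

text \<open>
  Throughout, \<open>\<Omega>\<close> is an algebraic closure of the field \<open>k\<close>, and \<open>ks\<close> is the separable closure
  of \<open>k\<close> inside \<open>\<Omega>\<close>.
\<close>

text \<open>Over the algebraically closed \<open>\<Omega>\<close>: the minimal polynomial has no repeated root.\<close>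

definition (in ring) separable_over :: "'a set \<Rightarrow> 'a \<Rightarrow> bool" where
  "separable_over k x \<longleftrightarrow>
     (algebraic over k) x \<and> (\<forall>a \<in> carrier R. alg_mult (Irr k x) a \<le> 1)"

text \<open>
  The second conjunct determines \<open>ks\<close>; that this set is a subfield is a theorem of field theory,
  recorded here because \<open>ks\<close> is a given field.
\<close>

definition separable_closure :: "('a, 'm) ring_scheme \<Rightarrow> 'a set \<Rightarrow> 'a set \<Rightarrow> bool" where
  "separable_closure \<Omega> k ks \<longleftrightarrow>
     subfield ks \<Omega> \<and> ks = {x \<in> carrier \<Omega>. ring.separable_over \<Omega> k x}"

definition galois_group :: "('a, 'm) ring_scheme \<Rightarrow> 'a set \<Rightarrow> 'a set \<Rightarrow> ('a \<Rightarrow> 'a) monoid" where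
  "galois_group \<Omega> k ks =
     (BijGroup ks) \<lparr> carrier := {\<sigma> \<in> Bij ks.
        \<sigma> \<in> ring_hom (\<Omega>\<lparr> carrier := ks \<rparr>) (\<Omega>\<lparr> carrier := ks \<rparr>) \<and> (\<forall>x \<in> k. \<sigma> x = x)} \<rparr>"

section \<open>Varieties\<close>

text \<open>
  A \<open>k\<close>-variety (a geometrically reduced separated \<open>k\<close>-scheme of finite type, not necessarily
  irreducible or connected) is given in the classical way by its set of \<open>\<Omega>\<close>-valued points
  together with a finite atlas of affine charts defined over \<open>k\<close>.  One cannot work with
  \<open>ks\<close>-valued points alone: over an imperfect field they do not see all closed points, so they
  determine neither the open subsets nor the regular functions.
\<close>

definition affine_space :: "('a, 'm) ring_scheme \<Rightarrow> nat \<Rightarrow> 'a list set" where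
  "affine_space \<Omega> n = {z. length z = n \<and> set z \<subseteq> carrier \<Omega>}"

text \<open>
  Polynomials in \<open>n\<close> variables with coefficients in \<open>F\<close>, as functions of the coordinate vector
  (no information is lost, because \<open>\<Omega>\<close> is infinite).
\<close>

inductive_set polyfun :: "('a, 'm) ring_scheme \<Rightarrow> 'a set \<Rightarrow> nat \<Rightarrow> ('a list \<Rightarrow> 'a) set"
  for \<Omega> F n where
  const: "c \<in> F \<Longrightarrow> (\<lambda>z. c) \<in> polyfun \<Omega> F n"
| var: "i < n \<Longrightarrow> (\<lambda>z. z ! i) \<in> polyfun \<Omega> F n"
| add: "p \<in> polyfun \<Omega> F n \<Longrightarrow> q \<in> polyfun \<Omega> F n \<Longrightarrow> (\<lambda>z. p z \<oplus>\<^bsub>\<Omega>\<^esub> q z) \<in> polyfun \<Omega> F n"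
| mult: "p \<in> polyfun \<Omega> F n \<Longrightarrow> q \<in> polyfun \<Omega> F n \<Longrightarrow> (\<lambda>z. p z \<otimes>\<^bsub>\<Omega>\<^esub> q z) \<in> polyfun \<Omega> F n"

definition zariski_closed :: "('a, 'm) ring_scheme \<Rightarrow> 'a set \<Rightarrow> nat \<Rightarrow> 'a list set \<Rightarrow> bool" where
  "zariski_closed \<Omega> F n Z \<longleftrightarrow>
     (\<exists>S \<subseteq> polyfun \<Omega> F n. Z = {z \<in> affine_space \<Omega> n. \<forall>p \<in> S. p z = \<zero>\<^bsub>\<Omega>\<^esub>})"

text \<open>
  \<open>Z\<close> is defined over \<open>k\<close>: it is cut out by polynomials over \<open>k\<close>, and its full vanishing ideal
  over \<open>\<Omega>\<close> is generated by polynomials over \<open>k\<close>.  The second condition (geometric reducedness)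
  does not follow from the first when \<open>k\<close> is imperfect.
\<close>

definition affine_variety :: "('a, 'm) ring_scheme \<Rightarrow> 'a set \<Rightarrow> nat \<Rightarrow> 'a list set \<Rightarrow> bool" where
  "affine_variety \<Omega> k n Z \<longleftrightarrow> zariski_closed \<Omega> k n Z \<and>
     (\<forall>p \<in> polyfun \<Omega> (carrier \<Omega>) n. (\<forall>z \<in> Z. p z = \<zero>\<^bsub>\<Omega>\<^esub>) \<longrightarrow>
        (\<exists>(N::nat) a q.
           (\<forall>i < N. a i \<in> polyfun \<Omega> (carrier \<Omega>) n \<and> q i \<in> polyfun \<Omega> k n
                   \<and> (\<forall>z \<in> Z. q i z = \<zero>\<^bsub>\<Omega>\<^esub>)) \<and>
           (\<forall>z \<in> affine_space \<Omega> n. p z = (\<Oplus>\<^bsub>\<Omega>\<^esub>i \<in> {..<N}. a i z \<otimes>\<^bsub>\<Omega>\<^esub> q i z))))"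

record ('v, 'a) chart =
  cdom :: "'v set"
  cdim :: nat
  coords :: "'v \<Rightarrow> 'a list"

definition open_in_chart ::
  "('a, 'm) ring_scheme \<Rightarrow> 'a set \<Rightarrow> ('v, 'a) chart \<Rightarrow> 'v set \<Rightarrow> bool" where
  "open_in_chart \<Omega> F c U \<longleftrightarrow>
     (\<exists>S \<subseteq> polyfun \<Omega> F (cdim c). U = {x \<in> cdom c. \<exists>p \<in> S. p (coords c x) \<noteq> \<zero>\<^bsub>\<Omega>\<^esub>})"

text \<open>\<open>h\<close> is locally on \<open>U\<close> a quotient of polynomials over \<open>F\<close> in the coordinates of \<open>c\<close>.\<close>

definition regular_on ::
  "('a, 'm) ring_scheme \<Rightarrow> 'a set \<Rightarrow> ('v, 'a) chart \<Rightarrow> 'v set \<Rightarrow> ('v \<Rightarrow> 'a) \<Rightarrow> bool" where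
  "regular_on \<Omega> F c U h \<longleftrightarrow>
     (\<forall>x \<in> U. \<exists>p \<in> polyfun \<Omega> F (cdim c). \<exists>q \<in> polyfun \<Omega> F (cdim c).
        q (coords c x) \<noteq> \<zero>\<^bsub>\<Omega>\<^esub> \<and>
        (\<forall>y \<in> U. q (coords c y) \<noteq> \<zero>\<^bsub>\<Omega>\<^esub> \<longrightarrow>
                 h y = p (coords c y) \<otimes>\<^bsub>\<Omega>\<^esub> inv\<^bsub>\<Omega>\<^esub> (q (coords c y))))"

text \<open>The last condition is separatedness: the diagonal is closed.\<close>

definition variety :: "('a, 'm) ring_scheme \<Rightarrow> 'a set \<Rightarrow> ('v, 'a) chart set \<Rightarrow> bool" where
  "variety \<Omega> k A \<longleftrightarrow> finite A \<and>
     (\<forall>c \<in> A. inj_on (coords c) (cdom c) \<and> affine_variety \<Omega> k (cdim c) (coords c ` cdom c)) \<and>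
     (\<forall>c \<in> A. \<forall>d \<in> A.
        open_in_chart \<Omega> k c (cdom c \<inter> cdom d) \<and>
        (\<forall>i < cdim d. regular_on \<Omega> k c (cdom c \<inter> cdom d) (\<lambda>x. coords d x ! i)) \<and>
        zariski_closed \<Omega> k (cdim c + cdim d)
          ((\<lambda>x. coords c x @ coords d x) ` (cdom c \<inter> cdom d)))"

definition atlas_points :: "('v, 'a) chart set \<Rightarrow> 'v set" where
  "atlas_points A = (\<Union>c \<in> A. cdom c)"

text \<open>Morphisms defined over a field \<open>F\<close> between \<open>k\<close> and \<open>\<Omega>\<close>.\<close>

definition regular_map :: "('a, 'm) ring_scheme \<Rightarrow> 'a set \<Rightarrow> ('v, 'a) chart set \<Rightarrow>
    ('w, 'a) chart set \<Rightarrow> ('v \<Rightarrow> 'w) \<Rightarrow> bool" where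
  "regular_map \<Omega> F A B f \<longleftrightarrow> f \<in> atlas_points A \<rightarrow> atlas_points B \<and>
     (\<forall>c \<in> A. \<forall>d \<in> B.
        open_in_chart \<Omega> F c (cdom c \<inter> f -` cdom d) \<and>
        (\<forall>i < cdim d. regular_on \<Omega> F c (cdom c \<inter> f -` cdom d) (\<lambda>x. coords d (f x) ! i)))"

definition rational_points :: "'a set \<Rightarrow> ('v, 'a) chart set \<Rightarrow> 'v set" where
  "rational_points F A = {x. \<exists>c \<in> A. x \<in> cdom c \<and> set (coords c x) \<subseteq> F}"

text \<open>
  The action of the Galois group on \<open>ks\<close>-rational points: \<open>\<gamma>\<close> is applied to the coordinates in
  any chart around the point (the charts and transition maps are defined over \<open>k\<close>).
\<close>

definition galois_act :: "('v, 'a) chart set \<Rightarrow> ('a \<Rightarrow> 'a) \<Rightarrow> 'v \<Rightarrow> 'v" where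
  "galois_act A \<gamma> x =
     (THE y. \<exists>c \<in> A. x \<in> cdom c \<and> y \<in> cdom c \<and> coords c y = map \<gamma> (coords c x))"

text \<open>The \<open>d\<close>-fold power of a variety; its points are lists of length \<open>d\<close>.\<close>

definition power_chart :: "('v, 'a) chart list \<Rightarrow> ('v list, 'a) chart" where
  "power_chart cs =
     \<lparr> cdom = {xs. list_all2 (\<lambda>x c. x \<in> cdom c) xs cs},
       cdim = sum_list (map cdim cs),
       coords = (\<lambda>xs. concat (map2 coords cs xs)) \<rparr>"

definition power_atlas :: "('v, 'a) chart set \<Rightarrow> nat \<Rightarrow> ('v list, 'a) chart set" where
  "power_atlas A d = power_chart ` {cs. length cs = d \<and> set cs \<subseteq> A}"

section \<open>Modules\<close>

text \<open>The multiplication and the unit of a module record carry no meaning in the library.\<close>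

definition linear_maps :: "('o, 'r) ring_scheme \<Rightarrow> ('o, 'm, 'x) module_scheme \<Rightarrow>
    ('o, 'n, 'y) module_scheme \<Rightarrow> ('m \<Rightarrow> 'n) set" where
  "linear_maps R M N = {h \<in> carrier M \<rightarrow> carrier N.
     (\<forall>x \<in> carrier M. \<forall>y \<in> carrier M. h (x \<oplus>\<^bsub>M\<^esub> y) = h x \<oplus>\<^bsub>N\<^esub> h y) \<and>
     (\<forall>a \<in> carrier R. \<forall>x \<in> carrier M. h (a \<odot>\<^bsub>M\<^esub> x) = a \<odot>\<^bsub>N\<^esub> h x)}"

definition linear_isos :: "('o, 'r) ring_scheme \<Rightarrow> ('o, 'm, 'x) module_scheme \<Rightarrow>
    ('o, 'n, 'y) module_scheme \<Rightarrow> ('m \<Rightarrow> 'n) set" where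
  "linear_isos R M N = {h \<in> linear_maps R M N. bij_betw h (carrier M) (carrier N)}"

definition power_module :: "('o, 'm, 'x) module_scheme \<Rightarrow> nat \<Rightarrow> ('o, 'm list) module" where
  "power_module M d =
     \<lparr> carrier = {xs. length xs = d \<and> set xs \<subseteq> carrier M},
       monoid.mult = undefined, one = undefined,
       ring.zero = replicate d \<zero>\<^bsub>M\<^esub>,
       add = map2 (add M),
       smult = (\<lambda>a. map (smult M a)) \<rparr>"

definition free_module :: "('o, 'r) ring_scheme \<Rightarrow> nat \<Rightarrow> ('o, 'o list) module" where
  "free_module R d =
     power_module \<lparr> carrier = carrier R, monoid.mult = monoid.mult R, one = one R,
                    ring.zero = ring.zero R, add = add R, smult = monoid.mult R \<rparr> d"

definition unit_vector :: "('o, 'r) ring_scheme \<Rightarrow> nat \<Rightarrow> nat \<Rightarrow> 'o list" where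
  "unit_vector R d i = (replicate d \<zero>\<^bsub>R\<^esub>)[i := \<one>\<^bsub>R\<^esub>]"

text \<open>
  The map \<open>M\<^sup>d \<rightarrow> M\<^sup>e\<close> induced by a linear map \<open>A : R\<^sup>d \<rightarrow> R\<^sup>e\<close>, namely multiplication of column
  vectors over \<open>M\<close> by the matrix of \<open>A\<close>, whose \<open>(i, j)\<close> entry is \<open>A (unit_vector R d j) ! i\<close>.
\<close>

definition matrix_act :: "('o, 'r) ring_scheme \<Rightarrow> ('o, 'm, 'x) module_scheme \<Rightarrow> nat \<Rightarrow> nat \<Rightarrow>
    ('o list \<Rightarrow> 'o list) \<Rightarrow> 'm list \<Rightarrow> 'm list" where
  "matrix_act R M d e A v =
     map (\<lambda>i. \<Oplus>\<^bsub>M\<^esub>j \<in> {..<d}. (A (unit_vector R d j) ! i) \<odot>\<^bsub>M\<^esub> (v ! j)) [0..<e]"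

text \<open>
  The tensor product is the quotient of the free abelian group on \<open>carrier M \<times> carrier N\<close> by the
  subgroup generated by the bilinearity relations; \<open>x \<otimes> y\<close> is the coset of \<open>frag_of (x, y)\<close>.
\<close>

definition tensor_free :: "('o, 'm, 'x) module_scheme \<Rightarrow> ('o, 'n, 'y) module_scheme \<Rightarrow>
    ('m \<times> 'n \<Rightarrow>\<^sub>0 int) monoid" where
  "tensor_free M N = free_Abelian_group (carrier M \<times> carrier N)"

definition tensor_relations :: "('o, 'r) ring_scheme \<Rightarrow> ('o, 'm, 'x) module_scheme \<Rightarrow>
    ('o, 'n, 'y) module_scheme \<Rightarrow> ('m \<times> 'n \<Rightarrow>\<^sub>0 int) set" where
  "tensor_relations R M N = generate (tensor_free M N)
     ({frag_of (x \<oplus>\<^bsub>M\<^esub> x', y) - frag_of (x, y) - frag_of (x', y) | x x' y.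
         x \<in> carrier M \<and> x' \<in> carrier M \<and> y \<in> carrier N} \<union>
      {frag_of (x, y \<oplus>\<^bsub>N\<^esub> y') - frag_of (x, y) - frag_of (x, y') | x y y'.
         x \<in> carrier M \<and> y \<in> carrier N \<and> y' \<in> carrier N} \<union>
      {frag_of (a \<odot>\<^bsub>M\<^esub> x, y) - frag_of (x, a \<odot>\<^bsub>N\<^esub> y) | a x y.
         a \<in> carrier R \<and> x \<in> carrier M \<and> y \<in> carrier N})"

text \<open>
  \<open>tensor_map R M' N' f g\<close> is \<open>f \<otimes> g\<close>, with values in the tensor product of \<open>M'\<close> and \<open>N'\<close>.
\<close>

definition tensor_map :: "('o, 'r) ring_scheme \<Rightarrow> ('o, 'm2, 'x) module_scheme \<Rightarrow>
    ('o, 'n2, 'y) module_scheme \<Rightarrow> ('m \<Rightarrow> 'm2) \<Rightarrow> ('n \<Rightarrow> 'n2) \<Rightarrow>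
    ('m \<times> 'n \<Rightarrow>\<^sub>0 int) set \<Rightarrow> ('m2 \<times> 'n2 \<Rightarrow>\<^sub>0 int) set" where
  "tensor_map R M' N' f g U =
     (\<Union>c \<in> U. r_coset (tensor_free M' N') (tensor_relations R M' N')
        (frag_extend (\<lambda>(x, y). frag_of (f x, g y)) c))"

definition tensor :: "('o, 'r) ring_scheme \<Rightarrow> ('o, 'm, 'x) module_scheme \<Rightarrow>
    ('o, 'n, 'y) module_scheme \<Rightarrow> ('o, ('m \<times> 'n \<Rightarrow>\<^sub>0 int) set) module" where
  "tensor R M N =
     (let Q = tensor_free M N Mod tensor_relations R M N in
      \<lparr> carrier = carrier Q,
        monoid.mult = undefined, one = undefined,
        ring.zero = one Q,
        add = monoid.mult Q,
        smult = (\<lambda>a. tensor_map R M N (\<lambda>x. a \<odot>\<^bsub>M\<^esub> x) (\<lambda>y. y)) \<rparr>)"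

definition torsion :: "nat \<Rightarrow> ('o, 'm, 'x) module_scheme \<Rightarrow> ('o, 'm, 'x) module_scheme" where
  "torsion n M = M\<lparr> carrier := {x \<in> carrier M. [n] \<cdot>\<^bsub>M\<^esub> x = \<zero>\<^bsub>M\<^esub>} \<rparr>"

text \<open>The inverse limit of the \<open>M[l\<^sup>m]\<close> under multiplication by \<open>l\<close>, as compatible sequences.\<close>

definition tate_module :: "nat \<Rightarrow> ('o, 'm, 'x) module_scheme \<Rightarrow> ('o, nat \<Rightarrow> 'm) module" where
  "tate_module l M =
     \<lparr> carrier = {s. \<forall>m. s m \<in> carrier (torsion (l ^ m) M) \<and> [l] \<cdot>\<^bsub>M\<^esub> s (Suc m) = s m},
       monoid.mult = undefined, one = undefined,
       ring.zero = (\<lambda>m. \<zero>\<^bsub>M\<^esub>),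
       add = (\<lambda>s t m. s m \<oplus>\<^bsub>M\<^esub> t m),
       smult = (\<lambda>a s m. a \<odot>\<^bsub>M\<^esub> s m) \<rparr>"

section \<open>The categories \<open>FMod\<close> and \<open>CAG\<close>\<close>

record ('o, 'i, 'a) galois_module = "('o, 'i) module" +
  ract :: "'i \<Rightarrow> ('a \<Rightarrow> 'a) \<Rightarrow> 'i"

text \<open>
  Finitely generated free modules with a linear right action of the Galois group that factors
  through \<open>Gal(L/k)\<close> for some finite Galois extension \<open>L\<close> of \<open>k\<close> inside \<open>ks\<close>.
\<close>

definition FMod :: "('a, 'm) ring_scheme \<Rightarrow> 'a set \<Rightarrow> 'a set \<Rightarrow> ('o, 'r) ring_scheme \<Rightarrow>
    ('o, 'i, 'a) galois_module set" where
  "FMod \<Omega> k ks R = {I. let G = galois_group \<Omega> k ks in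
     module R I \<and> (\<exists>d j. j \<in> linear_isos R (free_module R d) I) \<and>
     (\<forall>\<gamma> \<in> carrier G. (\<lambda>x. ract I x \<gamma>) \<in> linear_maps R I I) \<and>
     (\<forall>x \<in> carrier I. ract I x \<one>\<^bsub>G\<^esub> = x) \<and>
     (\<forall>x \<in> carrier I. \<forall>\<gamma> \<in> carrier G. \<forall>\<delta> \<in> carrier G.
        ract I x (\<gamma> \<otimes>\<^bsub>G\<^esub> \<delta>) = ract I (ract I x \<gamma>) \<delta>) \<and>
     (\<exists>L. subfield L \<Omega> \<and> k \<subseteq> L \<and> L \<subseteq> ks \<and> ring.finite_dimension \<Omega> k L \<and>
        (\<forall>\<gamma> \<in> carrier G. \<gamma> ` L = L) \<and>
        (\<forall>\<gamma> \<in> carrier G. \<forall>\<delta> \<in> carrier G. (\<forall>a \<in> L. \<gamma> a = \<delta> a) \<longrightarrow>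
           (\<forall>x \<in> carrier I. ract I x \<gamma> = ract I x \<delta>)))}"

definition FMod_homs :: "('a, 'm) ring_scheme \<Rightarrow> 'a set \<Rightarrow> 'a set \<Rightarrow> ('o, 'r) ring_scheme \<Rightarrow>
    ('o, 'i, 'a) galois_module \<Rightarrow> ('o, 'j, 'a) galois_module \<Rightarrow> ('i \<Rightarrow> 'j) set" where
  "FMod_homs \<Omega> k ks R I J = {f \<in> linear_maps R I J.
     \<forall>\<gamma> \<in> carrier (galois_group \<Omega> k ks). \<forall>x \<in> carrier I. f (ract I x \<gamma>) = ract J (f x) \<gamma>}"

text \<open>
  A commutative algebraic group with a ring homomorphism from \<open>R\<close> to its endomorphism ring: the
  carrier is the group of \<open>\<Omega>\<close>-valued points, and scalar multiplication is the action of \<open>R\<close>.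
  The module axioms say exactly that \<open>a \<mapsto> (x \<mapsto> a \<odot> x)\<close> is a unital ring homomorphism into the
  endomorphisms of the abstract group; these are required to be morphisms over \<open>k\<close>.
\<close>

record ('o, 'v, 'a) cag = "('o, 'v) module" +
  atlas :: "('v, 'a) chart set"

definition CAG :: "('a, 'm) ring_scheme \<Rightarrow> 'a set \<Rightarrow> ('o, 'r) ring_scheme \<Rightarrow>
    ('o, 'v, 'a) cag set" where
  "CAG \<Omega> k R = {V. module R V \<and> variety \<Omega> k (atlas V) \<and> carrier V = atlas_points (atlas V) \<and>
     regular_map \<Omega> k (power_atlas (atlas V) 2) (atlas V) (\<lambda>xs. xs ! 0 \<oplus>\<^bsub>V\<^esub> xs ! 1) \<and>
     regular_map \<Omega> k (atlas V) (atlas V) (\<lambda>x. \<ominus>\<^bsub>V\<^esub> x) \<and>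
     \<zero>\<^bsub>V\<^esub> \<in> rational_points k (atlas V) \<and>
     (\<forall>a \<in> carrier R. regular_map \<Omega> k (atlas V) (atlas V) (\<lambda>x. a \<odot>\<^bsub>V\<^esub> x))}"

definition CAG_homs :: "('a, 'm) ring_scheme \<Rightarrow> 'a set \<Rightarrow> ('o, 'r) ring_scheme \<Rightarrow>
    ('o, 'v, 'a) cag \<Rightarrow> ('o, 'w, 'a) cag \<Rightarrow> ('v \<Rightarrow> 'w) set" where
  "CAG_homs \<Omega> F R V W = {g \<in> linear_maps R V W. regular_map \<Omega> F (atlas V) (atlas W) g}"

definition CAG_isos :: "('a, 'm) ring_scheme \<Rightarrow> 'a set \<Rightarrow> ('o, 'r) ring_scheme \<Rightarrow>
    ('o, 'v, 'a) cag \<Rightarrow> ('o, 'w, 'a) cag \<Rightarrow> ('v \<Rightarrow> 'w) set" where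
  "CAG_isos \<Omega> F R V W = {g \<in> CAG_homs \<Omega> F R V W.
     bij_betw g (carrier V) (carrier W) \<and> inv_into (carrier V) g \<in> CAG_homs \<Omega> F R W V}"

definition CAG_power :: "('o, 'v, 'a) cag \<Rightarrow> nat \<Rightarrow> ('o, 'v list, 'a) cag" where
  "CAG_power V d = module.extend (power_module V d) (cag.fields (power_atlas (atlas V) d))"

text \<open>The module of \<open>F\<close>-rational points.\<close>

definition points :: "'a set \<Rightarrow> ('o, 'v, 'a) cag \<Rightarrow> ('o, 'v, 'a) cag" where
  "points F V = V\<lparr> carrier := rational_points F (atlas V) \<rparr>"

section \<open>Twists\<close>

text \<open>
  The data entering the definition of \<open>I \<otimes>\<^sub>R V\<close>: a basis \<open>tw_basis : R\<^sup>d \<rightarrow> I\<close> with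
  \<open>d = tw_rank\<close>, the twisted group \<open>tw_obj\<close>, and the isomorphism \<open>tw_iso : V\<^sup>d \<rightarrow> tw_obj\<close>.
\<close>

record ('o, 'i, 'v, 'w, 'a) twist =
  tw_I :: "('o, 'i, 'a) galois_module"
  tw_V :: "('o, 'v, 'a) cag"
  tw_rank :: nat
  tw_basis :: "'o list \<Rightarrow> 'i"
  tw_obj :: "('o, 'w, 'a) cag"
  tw_iso :: "'v list \<Rightarrow> 'w"

text \<open>
  The automorphism \<open>j\<^sup>-\<^sup>1 \<circ> j\<^sup>\<gamma>\<close> of \<open>R\<^sup>d\<close>, where \<open>j\<^sup>\<gamma> x = j(x) \<gamma>\<^sup>-\<^sup>1\<close>, and its image in the
  automorphisms of \<open>V\<^sup>d\<close>.
\<close>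

definition basis_cocycle :: "('a, 'm) ring_scheme \<Rightarrow> 'a set \<Rightarrow> 'a set \<Rightarrow> ('o, 'r) ring_scheme \<Rightarrow>
    ('o, 'i, 'v, 'w, 'a) twist \<Rightarrow> ('a \<Rightarrow> 'a) \<Rightarrow> 'o list \<Rightarrow> 'o list" where
  "basis_cocycle \<Omega> k ks R t \<gamma> x =
     inv_into (carrier (free_module R (tw_rank t))) (tw_basis t)
       (ract (tw_I t) (tw_basis t x) (inv\<^bsub>galois_group \<Omega> k ks\<^esub> \<gamma>))"

definition twist_cocycle :: "('a, 'm) ring_scheme \<Rightarrow> 'a set \<Rightarrow> 'a set \<Rightarrow> ('o, 'r) ring_scheme \<Rightarrow>
    ('o, 'i, 'v, 'w, 'a) twist \<Rightarrow> ('a \<Rightarrow> 'a) \<Rightarrow> 'v list \<Rightarrow> 'v list" where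
  "twist_cocycle \<Omega> k ks R t \<gamma> =
     matrix_act R (tw_V t) (tw_rank t) (tw_rank t) (basis_cocycle \<Omega> k ks R t \<gamma>)"

text \<open>The conjugate \<open>f\<^sup>\<gamma> = \<gamma> \<circ> f \<circ> \<gamma>\<^sup>-\<^sup>1\<close> of a morphism over \<open>ks\<close>, on \<open>ks\<close>-rational points.\<close>

definition conjugate_map :: "('a, 'm) ring_scheme \<Rightarrow> 'a set \<Rightarrow> 'a set \<Rightarrow>
    ('o, 'v, 'a) cag \<Rightarrow> ('o, 'w, 'a) cag \<Rightarrow> ('a \<Rightarrow> 'a) \<Rightarrow> ('v \<Rightarrow> 'w) \<Rightarrow> 'v \<Rightarrow> 'w" where
  "conjugate_map \<Omega> k ks V W \<gamma> f x =
     galois_act (atlas W) \<gamma> (f (galois_act (atlas V) (inv\<^bsub>galois_group \<Omega> k ks\<^esub> \<gamma>) x))"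

text \<open>
  \<open>twists \<Omega> k ks R\<close> consists of all pairs \<open>(I \<otimes>\<^sub>R V, \<phi>)\<close>, for all \<open>I\<close>, \<open>V\<close> and all choices of
  a basis.  The identity \<open>c(\<gamma>) = \<phi>\<^sup>-\<^sup>1 \<circ> \<phi>\<^sup>\<gamma>\<close> of morphisms over \<open>ks\<close> is stated on
  \<open>ks\<close>-rational points; these are dense, because \<open>V\<^sup>d\<close> is geometrically reduced.
\<close>

definition twists :: "('a, 'm) ring_scheme \<Rightarrow> 'a set \<Rightarrow> 'a set \<Rightarrow> ('o, 'r) ring_scheme \<Rightarrow>
    ('o, 'i, 'v, 'w, 'a) twist set" where
  "twists \<Omega> k ks R = {t. let d = tw_rank t; Vd = CAG_power (tw_V t) d in
     tw_I t \<in> FMod \<Omega> k ks R \<and> tw_V t \<in> CAG \<Omega> k R \<and>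
     tw_basis t \<in> linear_isos R (free_module R d) (tw_I t) \<and>
     tw_obj t \<in> CAG \<Omega> k R \<and>
     tw_iso t \<in> CAG_isos \<Omega> ks R Vd (tw_obj t) \<and>
     (\<forall>\<gamma> \<in> carrier (galois_group \<Omega> k ks). \<forall>v \<in> carrier (points ks Vd).
        twist_cocycle \<Omega> k ks R t \<gamma> v =
        inv_into (carrier Vd) (tw_iso t)
          (conjugate_map \<Omega> k ks Vd (tw_obj t) \<gamma> (tw_iso t) v))}"

text \<open>
  Pairs of a morphism of \<open>FMod\<close> and a morphism of \<open>CAG\<close>, and the morphism
  \<open>f \<otimes> g = \<phi>' \<circ> (j'\<^sup>-\<^sup>1 \<circ> f \<circ> j) \<circ> g\<^sup>d \<circ> \<phi>\<^sup>-\<^sup>1\<close> of twists which they induce.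
\<close>

definition twist_homs :: "('a, 'm) ring_scheme \<Rightarrow> 'a set \<Rightarrow> 'a set \<Rightarrow> ('o, 'r) ring_scheme \<Rightarrow>
    ('o, 'i, 'v, 'w, 'a) twist \<Rightarrow> ('o, 'i, 'v, 'w, 'a) twist \<Rightarrow> (('i \<Rightarrow> 'i) \<times> ('v \<Rightarrow> 'v)) set" where
  "twist_homs \<Omega> k ks R t t' =
     FMod_homs \<Omega> k ks R (tw_I t) (tw_I t') \<times> CAG_homs \<Omega> k R (tw_V t) (tw_V t')"

definition twist_map :: "('o, 'r) ring_scheme \<Rightarrow>
    ('o, 'i, 'v, 'w, 'a) twist \<Rightarrow> ('o, 'i, 'v, 'w, 'a) twist \<Rightarrow>
    ('i \<Rightarrow> 'i) \<Rightarrow> ('v \<Rightarrow> 'v) \<Rightarrow> 'w \<Rightarrow> 'w" where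
  "twist_map R t t' f g w =
     tw_iso t'
       (matrix_act R (tw_V t') (tw_rank t) (tw_rank t')
          (\<lambda>x. inv_into (carrier (free_module R (tw_rank t'))) (tw_basis t') (f (tw_basis t x)))
          (map g (inv_into (carrier (CAG_power (tw_V t) (tw_rank t))) (tw_iso t) w)))"

text \<open>
  A family of equivariant isomorphisms \<open>A t \<cong> B t\<close> of \<open>R\<close>-modules with \<open>G\<close>-action, indexed by
  \<open>t \<in> T\<close> and natural with respect to all \<open>(f, g) \<in> H t t'\<close>.  Here \<open>actA t \<gamma>\<close> is the action of
  \<open>\<gamma>\<close> on \<open>A t\<close>, \<open>mapA t t' f g : A t \<rightarrow> A t'\<close> the map induced by \<open>(f, g)\<close>, and similarly for \<open>B\<close>.
\<close>

definition functorially_isomorphic :: "('o, 'r) ring_scheme \<Rightarrow> ('g, 'q) monoid_scheme \<Rightarrow> 't set \<Rightarrow>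
    ('t \<Rightarrow> 't \<Rightarrow> ('f \<times> 'h) set) \<Rightarrow>
    ('t \<Rightarrow> ('o, 'm, 'x) module_scheme) \<Rightarrow> ('t \<Rightarrow> 'g \<Rightarrow> 'm \<Rightarrow> 'm) \<Rightarrow>
    ('t \<Rightarrow> 't \<Rightarrow> 'f \<Rightarrow> 'h \<Rightarrow> 'm \<Rightarrow> 'm) \<Rightarrow>
    ('t \<Rightarrow> ('o, 'n, 'y) module_scheme) \<Rightarrow> ('t \<Rightarrow> 'g \<Rightarrow> 'n \<Rightarrow> 'n) \<Rightarrow>
    ('t \<Rightarrow> 't \<Rightarrow> 'f \<Rightarrow> 'h \<Rightarrow> 'n \<Rightarrow> 'n) \<Rightarrow> bool" where
  "functorially_isomorphic R G T H A actA mapA B actB mapB \<longleftrightarrow>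
     (\<exists>\<Phi>. (\<forall>t \<in> T. \<Phi> t \<in> linear_isos R (A t) (B t) \<and>
              (\<forall>\<gamma> \<in> carrier G. \<forall>x \<in> carrier (A t). \<Phi> t (actA t \<gamma> x) = actB t \<gamma> (\<Phi> t x))) \<and>
          (\<forall>t \<in> T. \<forall>t' \<in> T. \<forall>(f, g) \<in> H t t'. \<forall>x \<in> carrier (A t).
              \<Phi> t' (mapA t t' f g x) = mapB t t' f g (\<Phi> t x)))"

end

theory Submission
  imports Defs
begin

text \<open>
  Write \<open>I\<close> for the free module, \<open>j : R\<^sup>d \<rightarrow> I\<close> for its basis, \<open>e\<^sub>i\<close> for the unit vectors,
  \<open>W\<close> for the twist of \<open>V\<close> by \<open>I\<close>, and \<open>\<phi> : V\<^sup>d \<rightarrow> W\<close> for the structure isomorphism over \<open>ks\<close>.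
  Two maps start from \<open>V(ks)\<^sup>d\<close>: the bijection \<open>\<phi>\<close> onto \<open>W(ks)\<close>, and the map
  \<open>\<psi>(v) = \<Sum>\<^sub>i j(e\<^sub>i) \<otimes> v\<^sub>i\<close> onto \<open>I \<otimes> V(ks)\<close>, which is bijective because \<open>j\<close> is a basis
  (\<open>basis_tensor_iso\<close>).  The isomorphism of (i) is \<open>\<psi> \<circ> \<phi>\<^sup>-\<^sup>1\<close>.

  Everything else follows from one identity (\<open>basis_tensor_natural\<close>): if \<open>f : I \<rightarrow> I'\<close> has the
  matrix \<open>B\<close> in the bases \<open>j\<close>, \<open>j'\<close> and \<open>g : M \<rightarrow> M'\<close> is linear, then
  \<open>\<psi>'(B (g v\<^sub>1, \<dots>, g v\<^sub>d)) = (f \<otimes> g)(\<psi> v)\<close>.  For a morphism \<open>(f, g)\<close> of the two categories this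
  is functoriality, because \<open>f \<otimes> g\<close> on twists is by definition given by \<open>B\<close> and \<open>g\<^sup>d\<close> in the
  coordinates \<open>\<phi>\<close>, \<open>\<phi>'\<close>.  For \<open>f = \<gamma>\<^sup>-\<^sup>1\<close> on \<open>I\<close> and \<open>g = \<gamma>\<close> on \<open>V(ks)\<close> the matrix \<open>B\<close> is the
  cocycle \<open>c(\<gamma>)\<close>, and the defining relation \<open>c(\<gamma>) = \<phi>\<^sup>-\<^sup>1 \<circ> \<gamma> \<circ> \<phi> \<circ> \<gamma>\<^sup>-\<^sup>1\<close> says precisely that
  \<open>\<gamma> (\<phi> v) = \<phi> (c(\<gamma>) (\<gamma> v))\<close>; this is equivariance.

  The data used here (a free module with a basis, modules \<open>M\<close> and \<open>A\<close>, an isomorphism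
  \<open>M\<^sup>d \<rightarrow> A\<close>, and the formulas for the actions and induced maps) are collected in the locale
  \<open>twisted_system\<close>.  Torsion and Tate modules commute with finite powers and with linear maps,
  so a system for \<open>M\<close> and \<open>A\<close> yields one for \<open>M[n]\<close>, \<open>A[n]\<close> and one for \<open>T\<^sub>l M\<close>, \<open>T\<^sub>l A\<close>, and
  (ii) and (iii) come from the same theorem as (i).

  Geometry enters only through two properties of a regular map: it preserves \<open>ks\<close>-rational
  points when it is defined over \<open>ks\<close>, and it commutes with \<open>\<gamma>\<close> on them when it is defined
  over \<open>k\<close>.  They make \<open>V(ks)\<close> a module with a linear Galois action, and restrict \<open>\<phi>\<close> to
  \<open>ks\<close>-rational points.
\<close>

section \<open>Tensor products as quotients of a free abelian group\<close>

definition tensor_class :: "('o, 'r) ring_scheme \<Rightarrow> ('o, 'm, 'x) module_scheme \<Rightarrow>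
    ('o, 'n, 'y) module_scheme \<Rightarrow> ('m \<times> 'n \<Rightarrow>\<^sub>0 int) \<Rightarrow> ('m \<times> 'n \<Rightarrow>\<^sub>0 int) set" where
  "tensor_class R M N c = r_coset (tensor_free M N) (tensor_relations R M N) c"

locale module_pair = M: module R M + N: module R N
  for R :: "('o, 'r) ring_scheme" and M :: "('o, 'm, 'x) module_scheme"
    and N :: "('o, 'n, 'y) module_scheme"
begin

abbreviation "Rel \<equiv> tensor_relations R M N"
abbreviation "F \<equiv> tensor_free M N"

lemma carrier_F: "c \<in> carrier F \<longleftrightarrow> Poly_Mapping.keys c \<subseteq> carrier M \<times> carrier N"
  by (simp add: tensor_free_def)

lemma F_comm_group: "comm_group F"
  by (simp add: tensor_free_def abelian_free_Abelian_group)

lemma F_group: "group F"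
  by (simp add: tensor_free_def)

lemma F_simps [simp]: "\<one>\<^bsub>F\<^esub> = 0" "c \<otimes>\<^bsub>F\<^esub> c' = c + c'"
  by (simp_all add: tensor_free_def)

lemma F_inv: "c \<in> carrier F \<Longrightarrow> inv\<^bsub>F\<^esub> c = - c"
  by (simp add: tensor_free_def)

lemma F_diff: "c \<in> carrier F \<Longrightarrow> c' \<in> carrier F \<Longrightarrow> c - c' \<in> carrier F"
  using keys_diff[of c c'] by (auto simp: carrier_F)

lemma F_add: "c \<in> carrier F \<Longrightarrow> c' \<in> carrier F \<Longrightarrow> c + c' \<in> carrier F"
  using keys_add[of c c'] by (auto simp: carrier_F)

lemma F_minus: "c \<in> carrier F \<Longrightarrow> - c \<in> carrier F"
  by (simp add: carrier_F)

lemma F_of: "frag_of (x, y) \<in> carrier F \<longleftrightarrow> x \<in> carrier M \<and> y \<in> carrier N"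
  by (simp add: carrier_F)

lemma F_sum: "(\<And>i. i \<in> A \<Longrightarrow> c i \<in> carrier F) \<Longrightarrow> sum c A \<in> carrier F"
  unfolding tensor_free_def by (rule sum_closed_free_Abelian_group)

lemma relations_subgroup: "subgroup Rel F"
  unfolding tensor_relations_def
  by (rule group.generate_is_subgroup[OF F_group])
    (auto simp: F_of intro!: F_diff)

lemma relations_normal: "Rel \<lhd> F"
  by (rule comm_group.subgroup_imp_normal[OF F_comm_group relations_subgroup])

lemma rel_carrier: "c \<in> Rel \<Longrightarrow> c \<in> carrier F"
  using subgroup.subset[OF relations_subgroup] by blast

lemma rel_zero: "0 \<in> Rel"
  using subgroup.one_closed[OF relations_subgroup] by simp

lemma rel_add: "c \<in> Rel \<Longrightarrow> c' \<in> Rel \<Longrightarrow> c + c' \<in> Rel"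
  using subgroup.m_closed[OF relations_subgroup] by simp

lemma rel_minus: "c \<in> Rel \<Longrightarrow> - c \<in> Rel"
  using subgroup.m_inv_closed[OF relations_subgroup, of c] by (simp add: rel_carrier F_inv)

lemma rel_diff: "c \<in> Rel \<Longrightarrow> c' \<in> Rel \<Longrightarrow> c - c' \<in> Rel"
  using rel_add[OF _ rel_minus, of c c'] by simp

lemma rel_sum: "(\<And>i. i \<in> A \<Longrightarrow> c i \<in> Rel) \<Longrightarrow> sum c A \<in> Rel"
  by (induction A rule: infinite_finite_induct) (auto intro: rel_zero rel_add)

lemma rel_add_left:
  "x \<in> carrier M \<Longrightarrow> x' \<in> carrier M \<Longrightarrow> y \<in> carrier N \<Longrightarrow>
   frag_of (x \<oplus>\<^bsub>M\<^esub> x', y) - frag_of (x, y) - frag_of (x', y) \<in> Rel"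
  unfolding tensor_relations_def by (rule generate.incl) blast

lemma rel_add_right:
  "x \<in> carrier M \<Longrightarrow> y \<in> carrier N \<Longrightarrow> y' \<in> carrier N \<Longrightarrow>
   frag_of (x, y \<oplus>\<^bsub>N\<^esub> y') - frag_of (x, y) - frag_of (x, y') \<in> Rel"
  unfolding tensor_relations_def by (rule generate.incl) blast

lemma rel_smult:
  "a \<in> carrier R \<Longrightarrow> x \<in> carrier M \<Longrightarrow> y \<in> carrier N \<Longrightarrow>
   frag_of (a \<odot>\<^bsub>M\<^esub> x, y) - frag_of (x, a \<odot>\<^bsub>N\<^esub> y) \<in> Rel"
  unfolding tensor_relations_def by (rule generate.incl) blast

text \<open>
  The relations are the smallest subgroup containing the generators, so a homomorphism out of
  the free abelian group respects them as soon as it respects the generators.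
\<close>

lemma rel_minimal:
  assumes "subgroup H F"
    and "\<And>x x' y. x \<in> carrier M \<Longrightarrow> x' \<in> carrier M \<Longrightarrow> y \<in> carrier N \<Longrightarrow>
           frag_of (x \<oplus>\<^bsub>M\<^esub> x', y) - frag_of (x, y) - frag_of (x', y) \<in> H"
    and "\<And>x y y'. x \<in> carrier M \<Longrightarrow> y \<in> carrier N \<Longrightarrow> y' \<in> carrier N \<Longrightarrow>
           frag_of (x, y \<oplus>\<^bsub>N\<^esub> y') - frag_of (x, y) - frag_of (x, y') \<in> H"
    and "\<And>a x y. a \<in> carrier R \<Longrightarrow> x \<in> carrier M \<Longrightarrow> y \<in> carrier N \<Longrightarrow>
           frag_of (a \<odot>\<^bsub>M\<^esub> x, y) - frag_of (x, a \<odot>\<^bsub>N\<^esub> y) \<in> H"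
  shows "Rel \<subseteq> H"
  unfolding tensor_relations_def
  by (rule group.generate_subgroup_incl[OF F_group _ assms(1)]) (use assms(2-) in auto)

text \<open>
  Equalities in the tensor product are proved below as congruences modulo the relations, where
  the additive structure of the free abelian group is available to the simplifier.
\<close>

lemma class_eq_iff:
  assumes "c \<in> carrier F" "c' \<in> carrier F"
  shows "tensor_class R M N c = tensor_class R M N c' \<longleftrightarrow> c - c' \<in> Rel"
proof
  assume "tensor_class R M N c = tensor_class R M N c'"
  then have "c \<in> Rel #>\<^bsub>F\<^esub> c'"
    using group.rcos_self[OF F_group assms(1) relations_subgroup] by (simp add: tensor_class_def)
  then show "c - c' \<in> Rel"
    using subgroup.rcos_module[OF relations_subgroup F_group assms(2,1)] assms(2)
    by (simp add: F_inv)
next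
  assume "c - c' \<in> Rel"
  then have "c \<in> Rel #>\<^bsub>F\<^esub> c'"
    using subgroup.rcos_module[OF relations_subgroup F_group assms(2,1)] assms(2)
    by (simp add: F_inv)
  then show "tensor_class R M N c = tensor_class R M N c'"
    using group.repr_independence[OF F_group _ assms(2) relations_subgroup]
    by (simp add: tensor_class_def)
qed

lemma class_self: "c \<in> carrier F \<Longrightarrow> c \<in> tensor_class R M N c"
  unfolding tensor_class_def by (rule group.rcos_self[OF F_group _ relations_subgroup])

lemma class_memD:
  assumes "c' \<in> tensor_class R M N c" "c \<in> carrier F"
  shows "c' - c \<in> Rel" "c' \<in> carrier F"
proof -
  obtain r where "r \<in> Rel" "c' = r + c"
    using assms(1) by (auto simp: tensor_class_def r_coset_def)
  then show "c' - c \<in> Rel" "c' \<in> carrier F"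
    using assms(2) rel_carrier by (auto intro: F_add)
qed

lemma carrier_tensor: "carrier (tensor R M N) = tensor_class R M N ` carrier F"
  by (auto simp: tensor_def Let_def FactGroup_def RCOSETS_def tensor_class_def)

lemma add_tensor:
  "c \<in> carrier F \<Longrightarrow> c' \<in> carrier F \<Longrightarrow>
   tensor_class R M N c \<oplus>\<^bsub>tensor R M N\<^esub> tensor_class R M N c' = tensor_class R M N (c + c')"
  using normal.rcos_sum[OF relations_normal, of c c']
  by (simp add: tensor_def Let_def FactGroup_def tensor_class_def)

text \<open>
  The universal property of the tensor product, phrased on representatives: a bilinear map
  extends additively to the free abelian group, and the extension takes equal values on
  congruent elements because it kills the generating relations.
\<close>

lemma bilinear_extension:
  assumes G: "comm_group G"
    and b: "\<And>x y. x \<in> carrier M \<Longrightarrow> y \<in> carrier N \<Longrightarrow> b x y \<in> carrier G"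
    and "\<And>x x' y. x \<in> carrier M \<Longrightarrow> x' \<in> carrier M \<Longrightarrow> y \<in> carrier N \<Longrightarrow>
           b (x \<oplus>\<^bsub>M\<^esub> x') y = b x y \<otimes>\<^bsub>G\<^esub> b x' y"
    and "\<And>x y y'. x \<in> carrier M \<Longrightarrow> y \<in> carrier N \<Longrightarrow> y' \<in> carrier N \<Longrightarrow>
           b x (y \<oplus>\<^bsub>N\<^esub> y') = b x y \<otimes>\<^bsub>G\<^esub> b x y'"
    and "\<And>a x y. a \<in> carrier R \<Longrightarrow> x \<in> carrier M \<Longrightarrow> y \<in> carrier N \<Longrightarrow>
           b (a \<odot>\<^bsub>M\<^esub> x) y = b x (a \<odot>\<^bsub>N\<^esub> y)"
  obtains h where "h \<in> hom F G"
    "\<And>x y. x \<in> carrier M \<Longrightarrow> y \<in> carrier N \<Longrightarrow> h (frag_of (x, y)) = b x y"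
    "\<And>c c'. c \<in> carrier F \<Longrightarrow> c' \<in> carrier F \<Longrightarrow> c - c' \<in> Rel \<Longrightarrow> h c = h c'"
proof -
  interpret G: comm_group G by fact
  obtain h where h: "h \<in> hom F G"
    and hof: "\<And>z. z \<in> carrier M \<times> carrier N \<Longrightarrow> h (frag_of z) = (case z of (x, y) \<Rightarrow> b x y)"
    using G.free_Abelian_group_universal[of "\<lambda>(x, y). b x y" "carrier M \<times> carrier N"] b
    unfolding tensor_free_def by (metis (mono_tags, lifting) SigmaE case_prod_conv image_subsetI)
  interpret h: group_hom F G h
    using h F_group by (simp add: group_hom_def group_hom_axioms_def)
  have hdiff: "h (c - c') = h c \<otimes>\<^bsub>G\<^esub> inv\<^bsub>G\<^esub> (h c')" if "c \<in> carrier F" "c' \<in> carrier F" for c c'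
    using h.hom_mult[OF that(1) group.inv_closed[OF F_group that(2)]] h.hom_inv[OF that(2)] that
    by (simp add: F_inv)
  have cancel: "p \<otimes>\<^bsub>G\<^esub> q \<otimes>\<^bsub>G\<^esub> inv\<^bsub>G\<^esub> p \<otimes>\<^bsub>G\<^esub> inv\<^bsub>G\<^esub> q = \<one>\<^bsub>G\<^esub>"
    if "p \<in> carrier G" "q \<in> carrier G" for p q
    using that by (simp add: G.m_comm[of p q] G.m_assoc)
  have "Rel \<subseteq> kernel F G h"
    by (rule rel_minimal[OF h.subgroup_kernel])
      (simp_all add: kernel_def F_diff F_of hdiff hof assms cancel)
  then have ker: "h c = \<one>\<^bsub>G\<^esub>" if "c \<in> Rel" for c
    using that by (auto simp: kernel_def)
  show ?thesis
  proof
    fix c c' assume c: "c \<in> carrier F" "c' \<in> carrier F" "c - c' \<in> Rel"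
    have "h c = h (c - c') \<otimes>\<^bsub>G\<^esub> h c'"
      using h.hom_mult[of "c - c'" c'] c by (simp add: F_diff)
    then show "h c = h c'" using ker[OF c(3)] c by simp
  qed (use h hof in auto)
qed

end

text \<open>
  \<open>f \<otimes> g\<close> is defined as a union over all representatives of a class.  A single representative
  computes it, since the linear maps \<open>f\<close> and \<open>g\<close> send relations to relations.
\<close>

lemma tensor_map_class:
  assumes "module R M" "module R N" "module R M'" "module R N'"
    and f: "f \<in> linear_maps R M M'" and g: "g \<in> linear_maps R N N'"
    and c: "c \<in> carrier (tensor_free M N)"
  shows "frag_extend (\<lambda>(x, y). frag_of (f x, g y)) c \<in> carrier (tensor_free M' N')" (is "?E c \<in> _")
    and "tensor_map R M' N' f g (tensor_class R M N c) =
      tensor_class R M' N' (frag_extend (\<lambda>(x, y). frag_of (f x, g y)) c)"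
proof -
  interpret MN: module_pair R M N using assms by (simp add: module_pair_def)
  interpret P: module_pair R M' N' using assms by (simp add: module_pair_def)
  have fc: "\<And>x. x \<in> carrier M \<Longrightarrow> f x \<in> carrier M'" and gc: "\<And>x. x \<in> carrier N \<Longrightarrow> g x \<in> carrier N'"
    using f g by (auto simp: linear_maps_def)
  have Ec: "?E c \<in> carrier P.F" if "c \<in> carrier MN.F" for c
  proof -
    have "Poly_Mapping.keys (case z of (x, y) \<Rightarrow> frag_of (f x, g y)) \<subseteq> carrier M' \<times> carrier N'"
      if "z \<in> Poly_Mapping.keys c" for z
    proof (cases z)
      case (Pair x y)
      then have "x \<in> carrier M" "y \<in> carrier N"
        using that \<open>c \<in> carrier MN.F\<close> unfolding MN.carrier_F by auto
      then show ?thesis using Pair fc gc by simp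
    qed
    then show ?thesis
      unfolding P.carrier_F by (intro order_trans[OF keys_frag_extend] UN_least)
  qed
  then show "?E c \<in> carrier P.F" using c .
  have "MN.Rel \<subseteq> {c \<in> carrier MN.F. ?E c \<in> P.Rel}"
  proof (rule MN.rel_minimal)
    show "subgroup {c \<in> carrier MN.F. ?E c \<in> P.Rel} MN.F"
    proof (rule group.subgroupI[OF MN.F_group])
      have "0 \<in> {c \<in> carrier MN.F. ?E c \<in> P.Rel}"
        using P.rel_zero by (simp add: MN.carrier_F)
      then show "{c \<in> carrier MN.F. ?E c \<in> P.Rel} \<noteq> {}" by blast
    qed (auto simp: MN.F_inv frag_extend_minus frag_extend_add P.rel_minus P.rel_add
          intro: MN.F_add MN.F_minus)
  qed (use f g in \<open>auto simp: MN.F_diff MN.F_of frag_extend_diff linear_maps_def Pi_iff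
        intro!: P.rel_add_left P.rel_add_right P.rel_smult\<close>)
  then have Erel: "?E c \<in> P.Rel" if "c \<in> MN.Rel" for c
    using that by auto
  have eq: "tensor_class R M' N' (?E c') = tensor_class R M' N' (?E c)"
    if "c' \<in> tensor_class R M N c" for c'
  proof -
    note m = MN.class_memD[OF that c]
    show ?thesis
      using Erel[OF m(1)] by (simp add: P.class_eq_iff Ec c m(2) frag_extend_diff)
  qed
  show "tensor_map R M' N' f g (tensor_class R M N c) = tensor_class R M' N' (?E c)"
    using eq MN.class_self[OF c] unfolding tensor_map_def tensor_class_def[symmetric] by blast
qed

section \<open>Tensoring with a free module\<close>

lemma unit_vector_carrier: "cring R \<Longrightarrow> unit_vector R d i \<in> carrier (free_module R d)"
proof -
  assume "cring R"
  then interpret cring R .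
  show ?thesis
    using set_update_subset_insert[of "replicate d \<zero>\<^bsub>R\<^esub>" i "\<one>\<^bsub>R\<^esub>"]
    by (auto simp: unit_vector_def free_module_def power_module_def)
qed

text \<open>
  A linear map on \<open>R\<^sup>d\<close> is determined by the unit vectors.  The proof truncates \<open>x\<close> after \<open>m\<close>
  entries and adds one multiple of a unit vector at a time, so that all finite sums are formed
  in \<open>M\<close>.
\<close>

lemma linear_map_expansion:
  assumes M: "module R M" and j: "j \<in> linear_maps R (free_module R d) M"
    and x: "x \<in> carrier (free_module R d)"
  shows "j x = (\<Oplus>\<^bsub>M\<^esub>i \<in> {..<d}. x ! i \<odot>\<^bsub>M\<^esub> j (unit_vector R d i))"
proof -
  interpret module R M by fact
  let ?Z = "free_module R d"
  have xl: "length x = d" and xc: "\<And>i. i < d \<Longrightarrow> x ! i \<in> carrier R"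
    using x by (auto simp: free_module_def power_module_def)
  have uc: "unit_vector R d i \<in> carrier ?Z" for i
    by (simp add: unit_vector_carrier R.is_cring)
  then have jc: "j (unit_vector R d i) \<in> carrier M" for i
    using j by (auto simp: linear_maps_def)
  define y where "y m = map (\<lambda>i. if i < m then x ! i else \<zero>\<^bsub>R\<^esub>) [0..<d]" for m
  have yc: "y m \<in> carrier ?Z" for m
    using xc by (auto simp: y_def free_module_def power_module_def)
  have "m \<le> d \<Longrightarrow> j (y m) = (\<Oplus>\<^bsub>M\<^esub>i \<in> {..<m}. x ! i \<odot>\<^bsub>M\<^esub> j (unit_vector R d i))" for m
  proof (induction m)
    case 0
    have "y 0 = \<zero>\<^bsub>R\<^esub> \<odot>\<^bsub>?Z\<^esub> y 0"
      by (auto simp: y_def free_module_def power_module_def)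
    then have "j (y 0) = \<zero>\<^bsub>R\<^esub> \<odot>\<^bsub>M\<^esub> j (y 0)"
      using j yc[of 0] unfolding linear_maps_def
      by (metis (mono_tags, lifting) R.zero_closed mem_Collect_eq)
    also have "\<dots> = \<zero>\<^bsub>M\<^esub>"
      using j yc[of 0] by (auto simp: linear_maps_def intro!: smult_l_null)
    finally show ?case by simp
  next
    case (Suc m)
    then have m: "m < d" by simp
    let ?e = "unit_vector R d m"
    have "y (Suc m) = y m \<oplus>\<^bsub>?Z\<^esub> (x ! m \<odot>\<^bsub>?Z\<^esub> ?e)"
      by (rule nth_equalityI)
        (use xc m in \<open>auto simp: y_def free_module_def power_module_def unit_vector_def
            nth_list_update less_Suc_eq\<close>)
    moreover have "x ! m \<odot>\<^bsub>?Z\<^esub> ?e \<in> carrier ?Z"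
      using uc[of m] xc[OF m] by (auto simp: free_module_def power_module_def)
    ultimately have "j (y (Suc m)) = j (y m) \<oplus>\<^bsub>M\<^esub> x ! m \<odot>\<^bsub>M\<^esub> j ?e"
      using j yc[of m] uc[of m] xc[OF m] by (simp add: linear_maps_def)
    also have "\<dots> = x ! m \<odot>\<^bsub>M\<^esub> j ?e \<oplus>\<^bsub>M\<^esub> j (y m)"
      using j yc[of m] jc xc[OF m] by (auto simp: linear_maps_def intro!: a_comm)
    also have "\<dots> = (\<Oplus>\<^bsub>M\<^esub>i \<in> {..<Suc m}. x ! i \<odot>\<^bsub>M\<^esub> j (unit_vector R d i))"
      using Suc m jc xc by (simp add: lessThan_Suc Pi_iff)
    finally show ?case .
  qed
  moreover have "y d = x"
    by (rule nth_equalityI) (auto simp: y_def xl)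
  ultimately show ?thesis by auto
qed


definition basis_sum :: "('o, 'r) ring_scheme \<Rightarrow> nat \<Rightarrow> ('o list \<Rightarrow> 'm) \<Rightarrow> 'n list \<Rightarrow> ('m \<times> 'n \<Rightarrow>\<^sub>0 int)" where
  "basis_sum R d j v = (\<Sum>i<d. frag_of (j (unit_vector R d i), v ! i))"

text \<open>
  The map \<open>\<psi> : N\<^sup>d \<rightarrow> M \<otimes> N\<close>, \<open>v \<mapsto> \<Sum>\<^sub>i j(e\<^sub>i) \<otimes> v\<^sub>i\<close>; \<open>basis_sum\<close> is a representative of its value.
\<close>

definition basis_tensor :: "('o, 'r) ring_scheme \<Rightarrow> ('o, 'm, 'x) module_scheme \<Rightarrow>
    ('o, 'n, 'y) module_scheme \<Rightarrow> nat \<Rightarrow> ('o list \<Rightarrow> 'm) \<Rightarrow> 'n list \<Rightarrow> ('m \<times> 'n \<Rightarrow>\<^sub>0 int) set" where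
  "basis_tensor R M N d j v = tensor_class R M N (basis_sum R d j v)"

context module_pair begin

lemma rel_zero_left: "y \<in> carrier N \<Longrightarrow> frag_of (\<zero>\<^bsub>M\<^esub>, y) \<in> Rel"
  using rel_minus[OF rel_add_left[of "\<zero>\<^bsub>M\<^esub>" "\<zero>\<^bsub>M\<^esub>" y]] by simp

lemma rel_zero_right: "x \<in> carrier M \<Longrightarrow> frag_of (x, \<zero>\<^bsub>N\<^esub>) \<in> Rel"
  using rel_minus[OF rel_add_right[of x "\<zero>\<^bsub>N\<^esub>" "\<zero>\<^bsub>N\<^esub>"]] by simp

text \<open>
  Sums over the empty set are covered because \<open>0 \<otimes> y\<close> and \<open>x \<otimes> 0\<close> vanish; iterating the two
  additivity relations gives the general case.
\<close>

lemma rel_finsum_left: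
  assumes "finite A" "y \<in> carrier N" "\<And>i. i \<in> A \<Longrightarrow> x i \<in> carrier M"
  shows "frag_of (\<Oplus>\<^bsub>M\<^esub>i \<in> A. x i, y) - (\<Sum>i\<in>A. frag_of (x i, y)) \<in> Rel"
  using assms(1,3)
proof (induction A rule: finite_induct)
  case empty
  then show ?case using rel_zero_left assms(2) by simp
next
  case (insert i A)
  let ?s = "\<Oplus>\<^bsub>M\<^esub>i \<in> A. x i"
  have "?s \<in> carrier M" using insert by (auto intro: M.M.finsum_closed)
  then have "frag_of (x i \<oplus>\<^bsub>M\<^esub> ?s, y) - frag_of (x i, y) - frag_of (?s, y) \<in> Rel"
    using insert assms(2) by (auto intro: rel_add_left)
  from rel_add[OF this insert.IH] insert.prems insert.hyps show ?case
    by (simp add: M.M.finsum_insert Pi_iff algebra_simps)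
qed

lemma rel_finsum_right:
  assumes "finite A" "x \<in> carrier M" "\<And>i. i \<in> A \<Longrightarrow> y i \<in> carrier N"
  shows "frag_of (x, \<Oplus>\<^bsub>N\<^esub>i \<in> A. y i) - (\<Sum>i\<in>A. frag_of (x, y i)) \<in> Rel"
  using assms(1,3)
proof (induction A rule: finite_induct)
  case empty
  then show ?case using rel_zero_right assms(2) by simp
next
  case (insert i A)
  let ?s = "\<Oplus>\<^bsub>N\<^esub>i \<in> A. y i"
  have "?s \<in> carrier N" using insert by (auto intro: N.M.finsum_closed)
  then have "frag_of (x, y i \<oplus>\<^bsub>N\<^esub> ?s) - frag_of (x, y i) - frag_of (x, ?s) \<in> Rel"
    using insert assms(2) by (auto intro: rel_add_right)
  from rel_add[OF this insert.IH] insert.prems insert.hyps show ?case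
    by (simp add: N.M.finsum_insert Pi_iff algebra_simps)
qed

end

locale free_module_pair = module_pair R M N
  for R :: "('o, 'r) ring_scheme" and M :: "('o, 'm, 'x) module_scheme"
    and N :: "('o, 'n, 'y) module_scheme" +
  fixes d :: nat and j :: "'o list \<Rightarrow> 'm"
  assumes j: "j \<in> linear_isos R (free_module R d) M"
begin

abbreviation e where "e i \<equiv> unit_vector R d i"

lemma j_lin: "j \<in> linear_maps R (free_module R d) M"
  using j by (simp add: linear_isos_def)

lemma e_carrier: "e i \<in> carrier (free_module R d)"
  by (simp add: unit_vector_carrier M.R.is_cring)

lemma je_carrier: "j (e i) \<in> carrier M"
  using j_lin e_carrier by (auto simp: linear_maps_def)

lemma basis_sum_carrier: "length v = d \<Longrightarrow> set v \<subseteq> carrier N \<Longrightarrow> basis_sum R d j v \<in> carrier F"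
  unfolding basis_sum_def by (rule F_sum) (auto simp: F_of je_carrier)

definition coord :: "nat \<Rightarrow> 'm \<Rightarrow> 'o" where
  "coord i x = inv_into (carrier (free_module R d)) j x ! i"

lemma inv_j:
  assumes "x \<in> carrier M"
  shows "inv_into (carrier (free_module R d)) j x \<in> carrier (free_module R d)"
    and "j (inv_into (carrier (free_module R d)) j x) = x"
  using j assms by (auto simp: linear_isos_def bij_betw_def inv_into_into f_inv_into_f)

lemma inv_j_eq:
  "y \<in> carrier (free_module R d) \<Longrightarrow> j y = x \<Longrightarrow> inv_into (carrier (free_module R d)) j x = y"
  using j by (auto simp: linear_isos_def bij_betw_def)

lemma coord_closed: "i < d \<Longrightarrow> x \<in> carrier M \<Longrightarrow> coord i x \<in> carrier R"
  using inv_j(1)[of x] by (auto simp: coord_def free_module_def power_module_def)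

lemma coord_expansion: "x \<in> carrier M \<Longrightarrow> x = (\<Oplus>\<^bsub>M\<^esub>i \<in> {..<d}. coord i x \<odot>\<^bsub>M\<^esub> j (e i))"
  using linear_map_expansion[OF M.module_axioms j_lin inv_j(1)] inv_j(2) by (simp add: coord_def)

lemma coord_add:
  assumes "i < d" "x \<in> carrier M" "x' \<in> carrier M"
  shows "coord i (x \<oplus>\<^bsub>M\<^esub> x') = coord i x \<oplus>\<^bsub>R\<^esub> coord i x'"
proof -
  let ?Z = "free_module R d" and ?k = "inv_into (carrier (free_module R d)) j"
  have c: "?k x \<oplus>\<^bsub>?Z\<^esub> ?k x' \<in> carrier ?Z"
    using inv_j(1)[OF assms(2)] inv_j(1)[OF assms(3)]
    by (force simp: free_module_def power_module_def set_zip set_conv_nth)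
  have "?k (x \<oplus>\<^bsub>M\<^esub> x') = ?k x \<oplus>\<^bsub>?Z\<^esub> ?k x'"
    by (rule inv_j_eq[OF c]) (use j_lin inv_j assms(2,3) in \<open>simp add: linear_maps_def\<close>)
  then show ?thesis
    using inv_j(1)[OF assms(2)] inv_j(1)[OF assms(3)] assms(1)
    by (simp add: coord_def free_module_def power_module_def)
qed

lemma coord_smult:
  assumes "i < d" "a \<in> carrier R" "x \<in> carrier M"
  shows "coord i (a \<odot>\<^bsub>M\<^esub> x) = a \<otimes>\<^bsub>R\<^esub> coord i x"
proof -
  let ?Z = "free_module R d" and ?k = "inv_into (carrier (free_module R d)) j"
  have c: "a \<odot>\<^bsub>?Z\<^esub> ?k x \<in> carrier ?Z"
    using inv_j(1)[OF assms(3)] assms(2)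
    by (auto simp: free_module_def power_module_def)
  have "?k (a \<odot>\<^bsub>M\<^esub> x) = a \<odot>\<^bsub>?Z\<^esub> ?k x"
    by (rule inv_j_eq[OF c]) (use j_lin inv_j assms(2,3) in \<open>simp add: linear_maps_def\<close>)
  then show ?thesis
    using inv_j(1)[OF assms(3)] assms(1)
    by (simp add: coord_def free_module_def power_module_def)
qed

lemma coord_basis: "i < d \<Longrightarrow> k < d \<Longrightarrow> coord i (j (e k)) = (if i = k then \<one>\<^bsub>R\<^esub> else \<zero>\<^bsub>R\<^esub>)"
  using inv_j_eq[OF e_carrier refl, of k] by (auto simp: coord_def unit_vector_def nth_list_update)

text \<open>
  The bilinear map \<open>(x, y) \<mapsto> coord\<^sub>i(x) y\<close> factors through the tensor product and sends
  \<open>\<psi> v\<close> to \<open>v\<^sub>i\<close>, so \<open>v\<close> can be read off from \<open>\<psi> v\<close>.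
\<close>

lemma basis_tensor_inj:
  assumes v: "length v = d" "set v \<subseteq> carrier N" and w: "length w = d" "set w \<subseteq> carrier N"
    and eq: "basis_tensor R M N d j v = basis_tensor R M N d j w"
  shows "v = w"
proof (rule nth_equalityI)
  fix i assume "i < length v"
  then have i: "i < d" using v by simp
  obtain h where hh: "h \<in> hom F (add_monoid N)"
    and hof: "\<And>x y. x \<in> carrier M \<Longrightarrow> y \<in> carrier N \<Longrightarrow> h (frag_of (x, y)) = coord i x \<odot>\<^bsub>N\<^esub> y"
    and hrel: "\<And>c c'. c \<in> carrier F \<Longrightarrow> c' \<in> carrier F \<Longrightarrow> c - c' \<in> Rel \<Longrightarrow> h c = h c'"
  proof (rule bilinear_extension[of "add_monoid N" "\<lambda>x y. coord i x \<odot>\<^bsub>N\<^esub> y"])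
    show "comm_group (add_monoid N)" by (rule N.M.a_comm_group)
  next
    fix a x y assume "a \<in> carrier R" "x \<in> carrier M" "y \<in> carrier N"
    then show "coord i (a \<odot>\<^bsub>M\<^esub> x) \<odot>\<^bsub>N\<^esub> y = coord i x \<odot>\<^bsub>N\<^esub> (a \<odot>\<^bsub>N\<^esub> y)"
      using i by (simp add: coord_smult coord_closed M.R.m_comm[of a] N.smult_assoc1)
  qed (use i in \<open>auto simp: coord_closed coord_add N.smult_l_distr N.smult_r_distr\<close>)
  have hsum: "h (\<Sum>k<m. frag_of (j (e k), u ! k)) = (if i < m then u ! i else \<zero>\<^bsub>N\<^esub>)"
    if "m \<le> d" and u: "length u = d" "set u \<subseteq> carrier N" for u m
    using that(1)
  proof (induction m)
    case 0
    \<comment> \<open>\<open>h 0 = 0\<close> because \<open>h 0 + h 0 = h 0\<close>\<close>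
    have "h 0 \<oplus>\<^bsub>N\<^esub> h 0 = h 0" "h 0 \<in> carrier N"
      using hom_mult[OF hh, of 0 0] hom_in_carrier[OF hh, of 0] by (simp_all add: carrier_F)
    then show ?case by (simp add: N.M.add.r_cancel_one)
  next
    case (Suc m)
    have um: "k < d \<Longrightarrow> u ! k \<in> carrier N" for k using u by auto
    have sm: "(\<Sum>k<m. frag_of (j (e k), u ! k)) \<in> carrier F"
      using Suc.prems um by (intro F_sum) (simp add: F_of je_carrier)
    have "h (\<Sum>k<Suc m. frag_of (j (e k), u ! k)) =
        h (\<Sum>k<m. frag_of (j (e k), u ! k)) \<oplus>\<^bsub>N\<^esub> coord i (j (e m)) \<odot>\<^bsub>N\<^esub> (u ! m)"
      using Suc.prems um hof[OF je_carrier um, of m m]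
        hom_mult[OF hh, of "\<Sum>k<m. frag_of (j (e k), u ! k)" "frag_of (j (e m), u ! m)"]
      by (simp add: F_of je_carrier sm)
    then show ?case
      using Suc i um by (auto simp: coord_basis less_Suc_eq)
  qed
  have "h (basis_sum R d j v) = h (basis_sum R d j w)"
    using eq v w by (intro hrel) (simp_all add: basis_sum_carrier basis_tensor_def class_eq_iff)
  then show "v ! i = w ! i"
    using hsum[OF order_refl v] hsum[OF order_refl w] i by (simp add: basis_sum_def)
qed (use v w in simp)

lemma basis_sum_add:
  assumes v: "length v = d" "set v \<subseteq> carrier N" and w: "length w = d" "set w \<subseteq> carrier N"
  shows "basis_sum R d j (map2 (add N) v w) - (basis_sum R d j v + basis_sum R d j w) \<in> Rel"
proof -
  have "(\<Sum>i<d. frag_of (j (e i), v ! i \<oplus>\<^bsub>N\<^esub> w ! i) - frag_of (j (e i), v ! i) - frag_of (j (e i), w ! i)) \<in> Rel"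
    using v w by (intro rel_sum rel_add_right je_carrier) auto
  moreover have "basis_sum R d j (map2 (add N) v w) = (\<Sum>i<d. frag_of (j (e i), v ! i \<oplus>\<^bsub>N\<^esub> w ! i))"
    unfolding basis_sum_def using v w by (intro sum.cong) auto
  ultimately show ?thesis
    by (simp add: basis_sum_def sum_subtractf sum.distrib algebra_simps)
qed

text \<open>
  The image of \<open>\<psi>\<close> is a subgroup, and it contains each \<open>x \<otimes> y = \<Sum>\<^sub>i x\<^sub>i j(e\<^sub>i) \<otimes> y = \<Sum>\<^sub>i j(e\<^sub>i) \<otimes> x\<^sub>i y\<close>.
\<close>

lemma basis_tensor_surj:
  assumes "c \<in> carrier F"
  shows "\<exists>v. length v = d \<and> set v \<subseteq> carrier N \<and> c - basis_sum R d j v \<in> Rel"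
proof -
  have "Poly_Mapping.keys c \<subseteq> carrier M \<times> carrier N" using assms by (simp add: carrier_F)
  then show ?thesis
  proof (induction c rule: frag_induction)
    case zero
    have "(\<Sum>i<d. frag_of (j (e i), \<zero>\<^bsub>N\<^esub>)) \<in> Rel"
      by (intro rel_sum rel_zero_right je_carrier)
    then have "0 - basis_sum R d j (replicate d \<zero>\<^bsub>N\<^esub>) \<in> Rel"
      using rel_minus by (simp add: basis_sum_def)
    then show ?case by (intro exI[of _ "replicate d \<zero>\<^bsub>N\<^esub>"]) auto
  next
    case (diff c c')
    obtain v where v: "length v = d" "set v \<subseteq> carrier N" "c - basis_sum R d j v \<in> Rel" using diff by blast
    obtain w where w: "length w = d" "set w \<subseteq> carrier N" "c' - basis_sum R d j w \<in> Rel" using diff by blast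
    \<comment> \<open>subtraction is the entrywise difference \<open>u\<close>, for which \<open>u + w = v\<close>\<close>
    define u where "u = map2 (\<lambda>x y. x \<ominus>\<^bsub>N\<^esub> y) v w"
    have u: "length u = d" "set u \<subseteq> carrier N"
      using v w by (auto simp: u_def elim!: in_set_zipE)
    have "map2 (add N) u w = v"
    proof (rule nth_equalityI)
      fix i assume "i < length (map2 (add N) u w)"
      then have "v ! i \<in> carrier N" "w ! i \<in> carrier N" "i < d"
        using u v w by (auto simp: subset_iff)
      then show "map2 (add N) u w ! i = v ! i"
        using u v w by (simp add: u_def a_minus_def N.M.a_assoc N.M.l_neg)
    qed (use u v w in simp)
    then have "basis_sum R d j v - (basis_sum R d j u + basis_sum R d j w) \<in> Rel"
      using basis_sum_add[OF u w(1,2)] by simp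
    from rel_add[OF rel_diff[OF v(3) w(3)] this]
    have "c - c' - basis_sum R d j u \<in> Rel" by (simp add: algebra_simps)
    then show ?case using u by blast
  next
    case (one a)
    then obtain x y where a: "a = (x, y)" and x: "x \<in> carrier M" and y: "y \<in> carrier N" by blast
    define v where "v = map (\<lambda>i. coord i x \<odot>\<^bsub>N\<^esub> y) [0..<d]"
    have v: "length v = d" "set v \<subseteq> carrier N"
      using x y by (auto simp: v_def coord_closed)
    have "frag_of (x, y) - (\<Sum>i<d. frag_of (coord i x \<odot>\<^bsub>M\<^esub> j (e i), y)) \<in> Rel"
      using rel_finsum_left[of "{..<d}" y "\<lambda>i. coord i x \<odot>\<^bsub>M\<^esub> j (e i)"] x y
      by (simp add: coord_closed je_carrier coord_expansion[OF x, symmetric])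
    moreover have "(\<Sum>i<d. frag_of (coord i x \<odot>\<^bsub>M\<^esub> j (e i), y) - frag_of (j (e i), coord i x \<odot>\<^bsub>N\<^esub> y)) \<in> Rel"
      using x y by (intro rel_sum rel_smult coord_closed je_carrier) auto
    moreover have "basis_sum R d j v = (\<Sum>i<d. frag_of (j (e i), coord i x \<odot>\<^bsub>N\<^esub> y))"
      unfolding basis_sum_def v_def by (intro sum.cong) auto
    ultimately have "frag_of (x, y) - basis_sum R d j v \<in> Rel"
      using rel_add by (fastforce simp: sum_subtractf)
    then show ?case using a v by blast
  qed
qed

lemma basis_tensor_iso: "basis_tensor R M N d j \<in> linear_isos R (power_module N d) (tensor R M N)"
proof -
  have c: "basis_sum R d j v \<in> carrier F" if "v \<in> carrier (power_module N d)" for v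
    using that by (auto simp: power_module_def basis_sum_carrier)
  have "basis_tensor R M N d j \<in> linear_maps R (power_module N d) (tensor R M N)"
    unfolding linear_maps_def mem_Collect_eq
  proof (intro conjI ballI Pi_I)
    fix v assume "v \<in> carrier (power_module N d)"
    then show "basis_tensor R M N d j v \<in> carrier (tensor R M N)"
      using c by (auto simp: basis_tensor_def carrier_tensor)
  next
    fix v w assume vw: "v \<in> carrier (power_module N d)" "w \<in> carrier (power_module N d)"
    let ?u = "v \<oplus>\<^bsub>power_module N d\<^esub> w"
    have u: "?u \<in> carrier (power_module N d)"
      using vw by (auto simp: power_module_def elim!: in_set_zipE)
    have "basis_sum R d j ?u - (basis_sum R d j v + basis_sum R d j w) \<in> Rel"
      using basis_sum_add vw by (simp add: power_module_def)
    then show "basis_tensor R M N d j ?u =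
        basis_tensor R M N d j v \<oplus>\<^bsub>tensor R M N\<^esub> basis_tensor R M N d j w"
      using c vw u by (simp add: basis_tensor_def add_tensor class_eq_iff F_add)
  next
    fix a v assume a: "a \<in> carrier R" and v: "v \<in> carrier (power_module N d)"
    let ?u = "a \<odot>\<^bsub>power_module N d\<^esub> v"
    have u: "?u \<in> carrier (power_module N d)"
      using a v by (auto simp: power_module_def)
    have lin: "(\<lambda>x. a \<odot>\<^bsub>M\<^esub> x) \<in> linear_maps R M M" "(\<lambda>y. y) \<in> linear_maps R N N"
      using a by (auto simp: linear_maps_def M.smult_r_distr M.smult_assoc1[symmetric] M.R.m_comm)
    let ?E = "frag_extend (\<lambda>(x, y). frag_of (a \<odot>\<^bsub>M\<^esub> x, y))"
    have E: "?E (basis_sum R d j v) = (\<Sum>i<d. frag_of (a \<odot>\<^bsub>M\<^esub> j (e i), v ! i))"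
      by (simp add: basis_sum_def frag_extend_sum o_def)
    note tm = tensor_map_class[OF M.module_axioms N.module_axioms M.module_axioms N.module_axioms lin c[OF v]]
    have "(\<Sum>i<d. frag_of (a \<odot>\<^bsub>M\<^esub> j (e i), v ! i) - frag_of (j (e i), a \<odot>\<^bsub>N\<^esub> (v ! i))) \<in> Rel"
      using a v by (intro rel_sum rel_smult je_carrier) (auto simp: power_module_def)
    moreover have "basis_sum R d j ?u = (\<Sum>i<d. frag_of (j (e i), a \<odot>\<^bsub>N\<^esub> (v ! i)))"
      unfolding basis_sum_def using v by (intro sum.cong) (auto simp: power_module_def)
    ultimately have "?E (basis_sum R d j v) - basis_sum R d j ?u \<in> Rel"
      by (simp add: E sum_subtractf)
    then have "tensor_class R M N (?E (basis_sum R d j v)) = tensor_class R M N (basis_sum R d j ?u)"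
      using tm(1) c[OF u] by (simp add: class_eq_iff)
    then show "basis_tensor R M N d j ?u = a \<odot>\<^bsub>tensor R M N\<^esub> basis_tensor R M N d j v"
      using tm(2) by (simp add: basis_tensor_def tensor_def Let_def)
  qed
  moreover have "inj_on (basis_tensor R M N d j) (carrier (power_module N d))"
    by (rule inj_onI) (rule basis_tensor_inj, auto simp: power_module_def)
  moreover have "carrier (tensor R M N) \<subseteq> basis_tensor R M N d j ` carrier (power_module N d)"
  proof
    fix U assume "U \<in> carrier (tensor R M N)"
    then obtain k where k: "k \<in> carrier F" "U = tensor_class R M N k" by (auto simp: carrier_tensor)
    obtain v where v: "length v = d" "set v \<subseteq> carrier N" "k - basis_sum R d j v \<in> Rel"
      using basis_tensor_surj[OF k(1)] by blast
    then have "U = basis_tensor R M N d j v"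
      using k by (simp add: basis_tensor_def class_eq_iff basis_sum_carrier)
    then show "U \<in> basis_tensor R M N d j ` carrier (power_module N d)"
      using v by (auto simp: power_module_def)
  qed
  ultimately show ?thesis
    by (auto simp: linear_isos_def linear_maps_def bij_betw_def)
qed

end

lemma map_linear:
  "g \<in> linear_maps R M N \<Longrightarrow> v \<in> carrier (power_module M d) \<Longrightarrow> map g v \<in> carrier (power_module N d)"
  by (auto simp: power_module_def linear_maps_def)

lemma matrix_act_carrier:
  assumes "module R N" and "A \<in> carrier (free_module R d) \<rightarrow> carrier (free_module R d')"
    and v: "v \<in> carrier (power_module N d)"
  shows "matrix_act R N d d' A v \<in> carrier (power_module N d')"
proof -
  interpret module R N by fact
  have "A (unit_vector R d i) ! k \<in> carrier R" if "k < d'" for i k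
  proof -
    have "A (unit_vector R d i) \<in> carrier (free_module R d')"
      using assms(2) unit_vector_carrier[OF R.is_cring] by blast
    then show ?thesis
      using that by (auto simp: free_module_def power_module_def)
  qed
  then show ?thesis
    using v by (auto simp: matrix_act_def power_module_def intro!: finsum_closed smult_closed)
qed

text \<open>
  With \<open>B\<^sub>i\<^sub>k\<close> the matrix of \<open>f\<close> and \<open>w\<^sub>k = g v\<^sub>k\<close>, both sides equal
  \<open>\<Sum>\<^sub>i\<^sub>,\<^sub>k j'(e\<^sub>i) \<otimes> B\<^sub>i\<^sub>k w\<^sub>k\<close>: on the left this is additivity in the second factor, on the right
  scalars move across and \<open>\<Sum>\<^sub>i B\<^sub>i\<^sub>k j'(e\<^sub>i) = f(j(e\<^sub>k))\<close>.
\<close>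

lemma basis_tensor_natural:
  assumes "module R M" "module R N" "module R M'" "module R N'"
    and j: "j \<in> linear_isos R (free_module R d) M"
    and j': "j' \<in> linear_isos R (free_module R d') M'"
    and f: "f \<in> linear_maps R M M'" and g: "g \<in> linear_maps R N N'"
    and v: "v \<in> carrier (power_module N d)"
  defines "A \<equiv> \<lambda>x. inv_into (carrier (free_module R d')) j' (f (j x))"
  shows "basis_tensor R M' N' d' j' (matrix_act R N' d d' A (map g v)) =
    tensor_map R M' N' f g (basis_tensor R M N d j v)"
proof -
  interpret P: free_module_pair R M N d j
    using assms by (simp add: free_module_pair_def module_pair_def free_module_pair_axioms_def)
  interpret Q: free_module_pair R M' N' d' j'
    using assms by (simp add: free_module_pair_def module_pair_def free_module_pair_axioms_def)
  have fc: "f (j x) \<in> carrier M'" if "x \<in> carrier (free_module R d)" for x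
    using that P.j_lin f by (auto simp: linear_maps_def)
  then have Ac: "A \<in> carrier (free_module R d) \<rightarrow> carrier (free_module R d')"
    unfolding A_def using Q.inv_j(1) by blast
  have gv: "map g v \<in> carrier (power_module N' d)"
    by (rule map_linear[OF g v])
  define w where "w = map g v"
  have w: "k < d \<Longrightarrow> w ! k \<in> carrier N'" "length w = d" for k
    using gv by (auto simp: w_def power_module_def)
  let ?a = "\<lambda>i k. Q.coord i (f (j (P.e k)))"
  have Ai: "A (P.e k) ! i = ?a i k" for i k
    by (simp add: A_def Q.coord_def)
  have ac: "?a i k \<in> carrier R" if "i < d'" for i k
    using that fc P.e_carrier Q.coord_closed by blast
  let ?u = "matrix_act R N' d d' A w"
  have u: "?u \<in> carrier (power_module N' d')"
    using matrix_act_carrier[OF assms(4) Ac gv] by (simp add: w_def)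
  have ui: "?u ! i = (\<Oplus>\<^bsub>N'\<^esub>k \<in> {..<d}. ?a i k \<odot>\<^bsub>N'\<^esub> (w ! k))" if "i < d'" for i
    using that by (simp add: matrix_act_def Ai)
  \<comment> \<open>the left-hand side expanded by additivity in the second factor\<close>
  have 1: "(\<Sum>i<d'. frag_of (j' (Q.e i), ?u ! i) -
      (\<Sum>k<d. frag_of (j' (Q.e i), ?a i k \<odot>\<^bsub>N'\<^esub> (w ! k)))) \<in> Q.Rel"
  proof (rule Q.rel_sum)
    fix i assume "i \<in> {..<d'}"
    then show "frag_of (j' (Q.e i), ?u ! i) -
      (\<Sum>k<d. frag_of (j' (Q.e i), ?a i k \<odot>\<^bsub>N'\<^esub> (w ! k))) \<in> Q.Rel"
      using ac w by (simp add: ui) (intro Q.rel_finsum_right, auto simp: Q.je_carrier)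
  qed
  \<comment> \<open>the scalars \<open>B\<^sub>i\<^sub>k\<close> move to the first factor\<close>
  have 2: "(\<Sum>i<d'. \<Sum>k<d. frag_of (?a i k \<odot>\<^bsub>M'\<^esub> j' (Q.e i), w ! k) -
      frag_of (j' (Q.e i), ?a i k \<odot>\<^bsub>N'\<^esub> (w ! k))) \<in> Q.Rel"
    using ac w by (intro Q.rel_sum Q.rel_smult) (auto simp: Q.je_carrier)
  \<comment> \<open>and are collected there into \<open>f(j(e\<^sub>k))\<close>\<close>
  have 3: "(\<Sum>k<d. frag_of (f (j (P.e k)), w ! k) -
      (\<Sum>i<d'. frag_of (?a i k \<odot>\<^bsub>M'\<^esub> j' (Q.e i), w ! k))) \<in> Q.Rel"
  proof (rule Q.rel_sum)
    fix k assume k: "k \<in> {..<d}"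
    have "frag_of (\<Oplus>\<^bsub>M'\<^esub>i \<in> {..<d'}. ?a i k \<odot>\<^bsub>M'\<^esub> j' (Q.e i), w ! k) -
      (\<Sum>i<d'. frag_of (?a i k \<odot>\<^bsub>M'\<^esub> j' (Q.e i), w ! k)) \<in> Q.Rel"
      using ac w k by (intro Q.rel_finsum_left) (auto simp: Q.je_carrier)
    then show "frag_of (f (j (P.e k)), w ! k) -
      (\<Sum>i<d'. frag_of (?a i k \<odot>\<^bsub>M'\<^esub> j' (Q.e i), w ! k)) \<in> Q.Rel"
      using Q.coord_expansion[OF fc[OF P.e_carrier[of k]]] by simp
  qed
  let ?E = "frag_extend (\<lambda>(x, y). frag_of (f x, g y))"
  have E: "?E (basis_sum R d j v) = (\<Sum>k<d. frag_of (f (j (P.e k)), w ! k))"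
    using v by (auto simp: basis_sum_def frag_extend_sum o_def w_def power_module_def intro!: sum.cong)
  have "basis_sum R d' j' ?u - ?E (basis_sum R d j v) \<in> Q.Rel"
    using Q.rel_diff[OF Q.rel_diff[OF 1 2] 3] unfolding E
    by (simp add: basis_sum_def sum_subtractf algebra_simps
        sum.swap[of "\<lambda>i k. frag_of (?a i k \<odot>\<^bsub>M'\<^esub> j' (Q.e i), w ! k)" "{..<d}" "{..<d'}"])
  moreover have bc: "basis_sum R d j v \<in> carrier P.F" "basis_sum R d' j' ?u \<in> carrier Q.F"
    using v u by (simp_all add: P.basis_sum_carrier Q.basis_sum_carrier power_module_def)
  moreover note tm = tensor_map_class[OF assms(1-4) f g bc(1)]
  ultimately show ?thesis
    by (simp add: basis_tensor_def tm(2) Q.class_eq_iff w_def)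
qed

section \<open>Linear maps and matrices\<close>

lemma power_module_closed:
  assumes "module R M"
  shows "v \<in> carrier (power_module M d) \<Longrightarrow> w \<in> carrier (power_module M d) \<Longrightarrow>
      v \<oplus>\<^bsub>power_module M d\<^esub> w \<in> carrier (power_module M d)"
    and "a \<in> carrier R \<Longrightarrow> v \<in> carrier (power_module M d) \<Longrightarrow>
      a \<odot>\<^bsub>power_module M d\<^esub> v \<in> carrier (power_module M d)"
proof -
  interpret module R M by fact
  show "v \<in> carrier (power_module M d) \<Longrightarrow> w \<in> carrier (power_module M d) \<Longrightarrow>
      v \<oplus>\<^bsub>power_module M d\<^esub> w \<in> carrier (power_module M d)"
    by (auto simp: power_module_def elim!: in_set_zipE)
  show "a \<in> carrier R \<Longrightarrow> v \<in> carrier (power_module M d) \<Longrightarrow>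
      a \<odot>\<^bsub>power_module M d\<^esub> v \<in> carrier (power_module M d)"
    by (auto simp: power_module_def)
qed

lemma linear_mapsD:
  assumes "h \<in> linear_maps R M N"
  shows "x \<in> carrier M \<Longrightarrow> h x \<in> carrier N"
    and "x \<in> carrier M \<Longrightarrow> y \<in> carrier M \<Longrightarrow> h (x \<oplus>\<^bsub>M\<^esub> y) = h x \<oplus>\<^bsub>N\<^esub> h y"
    and "a \<in> carrier R \<Longrightarrow> x \<in> carrier M \<Longrightarrow> h (a \<odot>\<^bsub>M\<^esub> x) = a \<odot>\<^bsub>N\<^esub> h x"
  using assms by (auto simp: linear_maps_def)

lemma linear_isosD:
  assumes "h \<in> linear_isos R M N"
  shows "h \<in> linear_maps R M N" "bij_betw h (carrier M) (carrier N)"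
    "x \<in> carrier M \<Longrightarrow> inv_into (carrier M) h (h x) = x"
    "y \<in> carrier N \<Longrightarrow> inv_into (carrier M) h y \<in> carrier M"
    "y \<in> carrier N \<Longrightarrow> h (inv_into (carrier M) h y) = y"
  using assms by (auto simp: linear_isos_def bij_betw_def f_inv_into_f inv_into_into)

lemma basis_change_closed:
  assumes "j \<in> linear_isos R (free_module R d) M" "j' \<in> linear_isos R (free_module R d') M'"
    and "f \<in> linear_maps R M M'"
  shows "(\<lambda>x. inv_into (carrier (free_module R d')) j' (f (j x)))
    \<in> carrier (free_module R d) \<rightarrow> carrier (free_module R d')"
  using linear_mapsD(1)[OF linear_isosD(1)[OF assms(1)]] linear_mapsD(1)[OF assms(3)]
    linear_isosD(4)[OF assms(2)] by blast

lemma linear_iso_power_inverse: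
  assumes M: "module R M" and h: "h \<in> linear_isos R (power_module M d) N"
  shows "inv_into (carrier (power_module M d)) h \<in> linear_isos R N (power_module M d)"
proof -
  note D = linear_isosD[OF h] and L = linear_mapsD[OF linear_isosD(1)[OF h]]
  let ?k = "inv_into (carrier (power_module M d)) h"
  have "?k (x \<oplus>\<^bsub>N\<^esub> y) = ?k x \<oplus>\<^bsub>power_module M d\<^esub> ?k y" if "x \<in> carrier N" "y \<in> carrier N" for x y
    using D(3)[OF power_module_closed(1)[OF M D(4)[OF that(1)] D(4)[OF that(2)]]]
    by (simp add: L(2) D(4,5) that)
  moreover have "?k (a \<odot>\<^bsub>N\<^esub> x) = a \<odot>\<^bsub>power_module M d\<^esub> ?k x" if "a \<in> carrier R" "x \<in> carrier N" for a x
    using D(3)[OF power_module_closed(2)[OF M that(1) D(4)[OF that(2)]]]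
    by (simp add: L(3) D(4,5) that)
  ultimately show ?thesis
    using D(4) bij_betw_inv_into[OF D(2)] by (auto simp: linear_isos_def linear_maps_def)
qed

lemma linear_isos_compose:
  "h \<in> linear_isos R M N \<Longrightarrow> k \<in> linear_isos R N P \<Longrightarrow> (\<lambda>x. k (h x)) \<in> linear_isos R M P"
  using bij_betw_trans[of h "carrier M" "carrier N" k "carrier P"]
  by (simp add: linear_isos_def linear_maps_def o_def Pi_iff)

lemma linear_map_finsum:
  assumes "module R M" "module R N" "h \<in> linear_maps R M N" "finite A" "f \<in> A \<rightarrow> carrier M"
  shows "h (\<Oplus>\<^bsub>M\<^esub>i \<in> A. f i) = (\<Oplus>\<^bsub>N\<^esub>i \<in> A. h (f i))"
proof -
  interpret M: module R M by fact
  interpret N: module R N by fact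
  note L = linear_mapsD[OF assms(3)]
  show ?thesis
    using assms(4,5)
  proof (induction A rule: finite_induct)
    case empty
    have "h \<zero>\<^bsub>M\<^esub> \<oplus>\<^bsub>N\<^esub> h \<zero>\<^bsub>M\<^esub> = h \<zero>\<^bsub>M\<^esub>"
      using L(2)[of "\<zero>\<^bsub>M\<^esub>" "\<zero>\<^bsub>M\<^esub>"] by simp
    then show ?case using L(1)[of "\<zero>\<^bsub>M\<^esub>"] by (simp add: N.M.add.r_cancel_one)
  next
    case (insert i A)
    then show ?case
      by (simp add: Pi_iff L M.M.finsum_closed)
  qed
qed

text \<open>
  This compares matrix actions over different modules in each case that arises: for the inclusion
  of a submodule, and for the evaluation of compatible sequences at a level of the Tate module.
\<close>

lemma matrix_act_natural:
  assumes "module R M" "module R N" "h \<in> linear_maps R M N"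
    and A: "A \<in> carrier (free_module R d) \<rightarrow> carrier (free_module R d')"
    and v: "v \<in> carrier (power_module M d)"
  shows "map h (matrix_act R M d d' A v) = matrix_act R N d d' A (map h v)"
proof (rule nth_equalityI)
  interpret M: module R M by fact
  interpret N: module R N by fact
  note L = linear_mapsD[OF assms(3)]
  fix i assume "i < length (map h (matrix_act R M d d' A v))"
  then have i: "i < d'" by (simp add: matrix_act_def)
  have a: "A (unit_vector R d k) ! i \<in> carrier R" for k
  proof -
    have "A (unit_vector R d k) \<in> carrier (free_module R d')"
      using A unit_vector_carrier[OF M.R.is_cring] by blast
    then show ?thesis
      using i by (auto simp: free_module_def power_module_def)
  qed
  have vc: "k < d \<Longrightarrow> v ! k \<in> carrier M" "length v = d" for k
    using v by (auto simp: power_module_def)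
  have "h (\<Oplus>\<^bsub>M\<^esub>k \<in> {..<d}. A (unit_vector R d k) ! i \<odot>\<^bsub>M\<^esub> (v ! k)) =
      (\<Oplus>\<^bsub>N\<^esub>k \<in> {..<d}. h (A (unit_vector R d k) ! i \<odot>\<^bsub>M\<^esub> (v ! k)))"
    by (rule linear_map_finsum[OF assms(1-3)]) (use a vc in auto)
  also have "\<dots> = (\<Oplus>\<^bsub>N\<^esub>k \<in> {..<d}. A (unit_vector R d k) ! i \<odot>\<^bsub>N\<^esub> (map h v ! k))"
    by (rule N.M.finsum_cong') (use a vc L in auto)
  finally show "map h (matrix_act R M d d' A v) ! i = matrix_act R N d d' A (map h v) ! i"
    using i by (simp add: matrix_act_def)
qed (simp add: matrix_act_def)

lemma add_pow_linear:
  assumes "module R M"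
  shows "(\<lambda>x. [(n::nat)] \<cdot>\<^bsub>M\<^esub> x) \<in> linear_maps R M M"
proof -
  interpret module R M by fact
  have "[n] \<cdot>\<^bsub>M\<^esub> (a \<odot>\<^bsub>M\<^esub> x) = a \<odot>\<^bsub>M\<^esub> ([n] \<cdot>\<^bsub>M\<^esub> x)" if "a \<in> carrier R" "x \<in> carrier M" for a x
    using that by (induction n) (auto simp: smult_r_distr)
  then show ?thesis
    by (auto simp: linear_maps_def M.add.nat_pow_distrib)
qed

lemma linear_map_zero:
  assumes "module R M" "module R N" "h \<in> linear_maps R M N"
  shows "h \<zero>\<^bsub>M\<^esub> = \<zero>\<^bsub>N\<^esub>"
  using linear_map_finsum[OF assms, of "{}" "\<lambda>_. undefined"] assms(1,2)
    by (simp add: abelian_monoid.finsum_empty module_def abelian_group_def)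

lemma linear_map_add_pow:
  assumes "module R M" "module R N" "h \<in> linear_maps R M N" "x \<in> carrier M"
  shows "h ([(n::nat)] \<cdot>\<^bsub>M\<^esub> x) = [n] \<cdot>\<^bsub>N\<^esub> h x"
proof -
  interpret M: module R M by fact
  interpret N: module R N by fact
  show ?thesis
    using assms(4) linear_mapsD[OF assms(3)] linear_map_zero[OF assms(1-3)] by (induction n) auto
qed

section \<open>Torsion and Tate modules\<close>

lemma torsion_simps [simp]:
  "add (torsion n M) = add M" "ring.zero (torsion n M) = ring.zero M"
  "smult (torsion n M) = smult M"
  "carrier (torsion n M) = {x \<in> carrier M. [n] \<cdot>\<^bsub>M\<^esub> x = \<zero>\<^bsub>M\<^esub>}"
  by (simp_all add: torsion_def)

lemma module_torsion:
  assumes "module R M"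
  shows "module R (torsion n M)"
proof -
  interpret module R M by fact
  note L = linear_mapsD[OF add_pow_linear[OF assms, of n]]
  have "submodule {x \<in> carrier M. [n] \<cdot>\<^bsub>M\<^esub> x = \<zero>\<^bsub>M\<^esub>} R M"
    by (rule submoduleI) (auto simp: L M.add.nat_pow_inv M.add.nat_pow_one)
  from submodule.submodule_is_module[OF this assms] show ?thesis
    by (simp add: torsion_def)
qed

lemma torsion_inclusion: "(\<lambda>x. x) \<in> linear_maps R (torsion n M) M"
  by (simp add: linear_maps_def)

lemma torsion_linear:
  assumes "module R M" "module R N" "h \<in> linear_maps R M N"
  shows "h \<in> linear_maps R (torsion n M) (torsion n N)"
  using linear_mapsD[OF assms(3)] linear_map_zero[OF assms]
  by (auto simp: linear_maps_def linear_map_add_pow[OF assms, symmetric])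

lemma power_iso_zero:
  assumes "module R M" "module R N" "h \<in> linear_maps R (power_module M d) N"
  shows "h (replicate d \<zero>\<^bsub>M\<^esub>) = \<zero>\<^bsub>N\<^esub>"
proof -
  interpret M: module R M by fact
  interpret N: module R N by fact
  note L = linear_mapsD[OF assms(3)]
  let ?z = "replicate d \<zero>\<^bsub>M\<^esub>"
  have z: "?z \<in> carrier (power_module M d)" by (auto simp: power_module_def)
  have "?z = \<zero>\<^bsub>R\<^esub> \<odot>\<^bsub>power_module M d\<^esub> ?z" by (simp add: power_module_def)
  then have "h ?z = \<zero>\<^bsub>R\<^esub> \<odot>\<^bsub>N\<^esub> h ?z" using L(3)[OF M.R.zero_closed z] by simp
  then show ?thesis using L(1)[OF z] by simp
qed

lemma power_iso_add_pow:
  assumes "module R M" "module R N" "h \<in> linear_maps R (power_module M d) N"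
    and v: "v \<in> carrier (power_module M d)"
  shows "h (map (\<lambda>x. [(n::nat)] \<cdot>\<^bsub>M\<^esub> x) v) = [n] \<cdot>\<^bsub>N\<^esub> h v"
proof (induction n)
  interpret M: module R M by fact
  interpret N: module R N by fact
  note L = linear_mapsD[OF assms(3)]
  {
    case 0
    have "map (\<lambda>x. [(0::nat)] \<cdot>\<^bsub>M\<^esub> x) v = replicate d \<zero>\<^bsub>M\<^esub>"
      using v by (auto simp: power_module_def map_replicate_const)
    then show ?case
      using power_iso_zero[OF assms(1-3)] by simp
  next
    case (Suc n)
    have "map (\<lambda>x. [Suc n] \<cdot>\<^bsub>M\<^esub> x) v = map (\<lambda>x. [n] \<cdot>\<^bsub>M\<^esub> x) v \<oplus>\<^bsub>power_module M d\<^esub> v"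
      by (rule nth_equalityI) (use v in \<open>auto simp: power_module_def\<close>)
    moreover have "map (\<lambda>x. [n] \<cdot>\<^bsub>M\<^esub> x) v \<in> carrier (power_module M d)"
      by (rule map_linear[OF add_pow_linear[OF assms(1)] v])
    ultimately show ?case
      using Suc L(2) v by simp
  }
qed

text \<open>
  \<open>h\<close> turns entrywise multiplication by \<open>n\<close> into multiplication by \<open>n\<close>, so a vector has
  \<open>n\<close>-torsion entries exactly when its image is \<open>n\<close>-torsion.
\<close>

lemma power_iso_torsion:
  assumes "module R M" "module R N" and h: "h \<in> linear_isos R (power_module M d) N"
  shows "h \<in> linear_isos R (power_module (torsion n M) d) (torsion n N)"
proof -
  note D = linear_isosD[OF h]
  note L = linear_mapsD[OF D(1)]
  let ?z = "replicate d \<zero>\<^bsub>M\<^esub>"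
  interpret M: module R M by fact
  have z: "?z \<in> carrier (power_module M d)" by (auto simp: power_module_def)
  have sub: "v \<in> carrier (power_module (torsion n M) d) \<longleftrightarrow>
      v \<in> carrier (power_module M d) \<and> [n] \<cdot>\<^bsub>N\<^esub> h v = \<zero>\<^bsub>N\<^esub>" for v
  proof -
    have "v \<in> carrier (power_module (torsion n M) d) \<longleftrightarrow>
        v \<in> carrier (power_module M d) \<and> map (\<lambda>x. [n] \<cdot>\<^bsub>M\<^esub> x) v = ?z"
      by (auto simp: power_module_def map_replicate_const[symmetric] map_eq_conv)
    moreover have "map (\<lambda>x. [n] \<cdot>\<^bsub>M\<^esub> x) v = ?z \<longleftrightarrow> [n] \<cdot>\<^bsub>N\<^esub> h v = \<zero>\<^bsub>N\<^esub>"
      if v: "v \<in> carrier (power_module M d)"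
    proof -
      have "map (\<lambda>x. [n] \<cdot>\<^bsub>M\<^esub> x) v = ?z \<longleftrightarrow> h (map (\<lambda>x. [n] \<cdot>\<^bsub>M\<^esub> x) v) = h ?z"
        using D(2) map_linear[OF add_pow_linear[OF assms(1)] v] z
        by (auto simp: bij_betw_def inj_on_eq_iff)
      then show ?thesis
        by (simp add: power_iso_add_pow[OF assms(1,2) D(1) v] power_iso_zero[OF assms(1,2) D(1)])
    qed
    ultimately show ?thesis by blast
  qed
  have "h ` carrier (power_module (torsion n M) d) = carrier (torsion n N)"
  proof (intro subset_antisym subsetI)
    fix x assume x: "x \<in> carrier (torsion n N)"
    then have "inv_into (carrier (power_module M d)) h x \<in> carrier (power_module (torsion n M) d)"
      using D(4,5)[of x] by (simp add: sub)
    then show "x \<in> h ` carrier (power_module (torsion n M) d)"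
      using D(5)[of x] x by (auto intro!: image_eqI[of x h])
  qed (use L in \<open>auto simp: sub\<close>)
  moreover have "inj_on h (carrier (power_module (torsion n M) d))"
    using D(2) sub by (auto simp: bij_betw_def inj_on_def)
  moreover have "add (power_module (torsion n M) d) = add (power_module M d)"
    "smult (power_module (torsion n M) d) = smult (power_module M d)"
    by (simp_all add: power_module_def)
  ultimately show ?thesis
    using L sub by (auto simp: linear_isos_def linear_maps_def bij_betw_def)
qed

lemma tate_simps [simp]:
  "add (tate_module l M) = (\<lambda>s t m. s m \<oplus>\<^bsub>M\<^esub> t m)"
  "ring.zero (tate_module l M) = (\<lambda>m. \<zero>\<^bsub>M\<^esub>)"
  "smult (tate_module l M) = (\<lambda>a s m. a \<odot>\<^bsub>M\<^esub> s m)"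
  by (simp_all add: tate_module_def)

lemma tate_carrier:
  "s \<in> carrier (tate_module l M) \<longleftrightarrow>
     (\<forall>m. s m \<in> carrier M \<and> [(l ^ m)] \<cdot>\<^bsub>M\<^esub> s m = \<zero>\<^bsub>M\<^esub> \<and> [l] \<cdot>\<^bsub>M\<^esub> s (Suc m) = s m)"
  by (auto simp: tate_module_def)

lemma module_tate:
  assumes "module R M"
  shows "module R (tate_module l M)"
proof -
  interpret module R M by fact
  note L = linear_mapsD[OF add_pow_linear[OF assms]]
  have sm: "a \<odot>\<^bsub>tate_module l M\<^esub> s \<in> carrier (tate_module l M)"
    if "a \<in> carrier R" "s \<in> carrier (tate_module l M)" for a s
    using that by (auto simp: tate_carrier L)
  have "abelian_group (tate_module l M)"
  proof (rule abelian_groupI)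
    fix s assume s: "s \<in> carrier (tate_module l M)"
    show "\<exists>t \<in> carrier (tate_module l M). t \<oplus>\<^bsub>tate_module l M\<^esub> s = \<zero>\<^bsub>tate_module l M\<^esub>"
      by (rule bexI[OF _ sm[OF _ s, of "\<ominus>\<^bsub>R\<^esub> \<one>\<^bsub>R\<^esub>"]])
        (use s in \<open>auto simp: tate_carrier smult_l_minus M.l_neg\<close>)
  qed (auto simp: tate_carrier L M.add.nat_pow_one M.a_ac)
  then show ?thesis
    by (intro moduleI R.is_cring sm)
      (auto simp: tate_carrier smult_l_distr smult_r_distr smult_assoc1)
qed

text \<open>
  Identities between compatible sequences are checked level by level through this map.
\<close>

lemma tate_evaluation: "(\<lambda>s. s m) \<in> linear_maps R (tate_module l M) M"
  by (simp add: linear_maps_def tate_carrier)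

lemma tate_linear:
  assumes "module R M" "module R N" "h \<in> linear_maps R M N"
  shows "(\<lambda>s. h \<circ> s) \<in> linear_maps R (tate_module l M) (tate_module l N)"
  using linear_mapsD[OF assms(3)] linear_map_zero[OF assms]
  by (auto simp: linear_maps_def tate_carrier linear_map_add_pow[OF assms, symmetric])

text \<open>
  A vector of compatible sequences is the same as a compatible sequence of vectors, and \<open>h\<close> maps
  the latter bijectively to compatible sequences in \<open>N\<close>, because it respects the torsion
  submodules and multiplication by \<open>l\<close>.
\<close>

lemma power_iso_tate:
  assumes M: "module R M" and N: "module R N" and h: "h \<in> linear_isos R (power_module M d) N"
  shows "(\<lambda>v m. h (map (\<lambda>s. s m) v)) \<in>
    linear_isos R (power_module (tate_module l M) d) (tate_module l N)" (is "?H \<in> _")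
proof -
  note D = linear_isosD[OF h] and D' = linear_isosD[OF power_iso_torsion[OF M N h]]
  note L = linear_mapsD[OF D(1)] and L' = linear_mapsD[OF D'(1)]
  let ?T = "tate_module l M" and ?S = "tate_module l N"
  have ev: "map (\<lambda>s. s m) v \<in> carrier (power_module (torsion (l ^ m) M) d)"
    "map (\<lambda>s. s m) v \<in> carrier (power_module M d)"
    "map (\<lambda>s. s m) v = map (\<lambda>x. [l] \<cdot>\<^bsub>M\<^esub> x) (map (\<lambda>s. s (Suc m)) v)"
    if "v \<in> carrier (power_module ?T d)" for v m
    using that by (auto simp: power_module_def tate_carrier subset_iff)
  have "?H v \<in> carrier ?S" if v: "v \<in> carrier (power_module ?T d)" for v
    unfolding tate_carrier
  proof (intro allI conjI)
    fix m
    show "h (map (\<lambda>s. s m) v) \<in> carrier N" "[(l ^ m)] \<cdot>\<^bsub>N\<^esub> h (map (\<lambda>s. s m) v) = \<zero>\<^bsub>N\<^esub>"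
      using L'(1)[OF ev(1)[OF v]] by auto
    show "[l] \<cdot>\<^bsub>N\<^esub> h (map (\<lambda>s. s (Suc m)) v) = h (map (\<lambda>s. s m) v)"
      unfolding ev(3)[OF v, of m] by (rule power_iso_add_pow[OF M N D(1) ev(2)[OF v], symmetric])
  qed
  moreover have "?H (v \<oplus>\<^bsub>power_module ?T d\<^esub> w) = ?H v \<oplus>\<^bsub>?S\<^esub> ?H w"
    if v: "v \<in> carrier (power_module ?T d)" and w: "w \<in> carrier (power_module ?T d)" for v w
  proof
    fix m
    have "map (\<lambda>s. s m) (v \<oplus>\<^bsub>power_module ?T d\<^esub> w) =
        map (\<lambda>s. s m) v \<oplus>\<^bsub>power_module M d\<^esub> map (\<lambda>s. s m) w"
      using v w by (auto simp: power_module_def intro!: nth_equalityI)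
    then show "?H (v \<oplus>\<^bsub>power_module ?T d\<^esub> w) m = (?H v \<oplus>\<^bsub>?S\<^esub> ?H w) m"
      using L(2)[OF ev(2)[OF v, of m] ev(2)[OF w, of m]] by simp
  qed
  moreover have "?H (a \<odot>\<^bsub>power_module ?T d\<^esub> v) = a \<odot>\<^bsub>?S\<^esub> ?H v"
    if a: "a \<in> carrier R" and v: "v \<in> carrier (power_module ?T d)" for a v
  proof
    fix m
    have "map (\<lambda>s. s m) (a \<odot>\<^bsub>power_module ?T d\<^esub> v) = a \<odot>\<^bsub>power_module M d\<^esub> map (\<lambda>s. s m) v"
      by (simp add: power_module_def)
    then show "?H (a \<odot>\<^bsub>power_module ?T d\<^esub> v) m = (a \<odot>\<^bsub>?S\<^esub> ?H v) m"
      using L(3)[OF a ev(2)[OF v, of m]] by simp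
  qed
  ultimately have lin: "?H \<in> linear_maps R (power_module ?T d) ?S"
    unfolding linear_maps_def by blast
  have inj: "inj_on ?H (carrier (power_module ?T d))"
  proof (rule inj_onI)
    fix v w assume v: "v \<in> carrier (power_module ?T d)" and w: "w \<in> carrier (power_module ?T d)"
      and "?H v = ?H w"
    then have "map (\<lambda>s. s m) v = map (\<lambda>s. s m) w" for m
      using D(3)[OF ev(2)[OF v, of m]] D(3)[OF ev(2)[OF w, of m]] by (metis (no_types, lifting))
    moreover have "length v = d" "length w = d" using v w by (auto simp: power_module_def)
    ultimately show "v = w"
      by (intro nth_equalityI ext) (auto dest: map_eq_imp_length_eq simp: list_eq_iff_nth_eq)
  qed
  have surj: "carrier ?S \<subseteq> ?H ` carrier (power_module ?T d)"
  proof
    fix s assume s: "s \<in> carrier ?S"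
    \<comment> \<open>pull \<open>s\<close> back level by level to vectors \<open>u m\<close>, then transpose to a vector \<open>v\<close> of sequences\<close>
    define u where "u m = inv_into (carrier (power_module M d)) h (s m)" for m
    have u: "u m \<in> carrier (power_module M d)" "h (u m) = s m" for m
      using s D(4,5) by (auto simp: u_def tate_carrier)
    have ut: "u m \<in> carrier (power_module (torsion (l ^ m) M) d)" for m
    proof -
      have st: "s m \<in> carrier (torsion (l ^ m) N)" using s by (simp add: tate_carrier)
      let ?w = "inv_into (carrier (power_module (torsion (l ^ m) M) d)) h (s m)"
      have "?w \<in> carrier (power_module M d)" "h ?w = s m"
        using D'(4,5)[OF st] by (auto simp: power_module_def)
      then have "u m = ?w" using D(3) by (metis u_def)
      then show ?thesis using D'(4)[OF st] by simp
    qed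
    have us: "map (\<lambda>x. [l] \<cdot>\<^bsub>M\<^esub> x) (u (Suc m)) = u m" for m
    proof -
      have c: "map (\<lambda>x. [l] \<cdot>\<^bsub>M\<^esub> x) (u (Suc m)) \<in> carrier (power_module M d)"
        by (rule map_linear[OF add_pow_linear[OF M] u(1)])
      have "h (map (\<lambda>x. [l] \<cdot>\<^bsub>M\<^esub> x) (u (Suc m))) = h (u m)"
        using s by (simp add: power_iso_add_pow[OF M N D(1) u(1)] u(2) tate_carrier)
      then show ?thesis using D(3)[OF c] D(3)[OF u(1)[of m]] by metis
    qed
    define v where "v = map (\<lambda>i m. u m ! i) [0..<d]"
    have ul: "length (u m) = d" for m using u(1)[of m] by (simp add: power_module_def)
    have vm: "map (\<lambda>s. s m) v = u m" for m
      by (rule nth_equalityI) (simp_all add: v_def ul)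
    have "(\<lambda>m. u m ! i) \<in> carrier ?T" if i: "i < d" for i
      unfolding tate_carrier
    proof (intro allI conjI)
      fix m
      have "u m ! i \<in> carrier (torsion (l ^ m) M)"
        using ut[of m] i nth_mem[of i "u m"] by (auto simp: power_module_def simp del: nth_mem)
      then show "u m ! i \<in> carrier M" "[(l ^ m)] \<cdot>\<^bsub>M\<^esub> (u m ! i) = \<zero>\<^bsub>M\<^esub>" by auto
      show "[l] \<cdot>\<^bsub>M\<^esub> (u (Suc m) ! i) = u m ! i"
        using us[of m] i ul[of "Suc m"] by (metis nth_map)
    qed
    then have "v \<in> carrier (power_module ?T d)" by (auto simp: v_def power_module_def)
    moreover have "?H v = s" by (simp add: vm u(2))
    ultimately show "s \<in> ?H ` carrier (power_module ?T d)" by blast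
  qed
  show ?thesis
    using lin inj surj unfolding linear_isos_def bij_betw_def linear_maps_def by blast
qed

section \<open>Twisted systems\<close>

text \<open>
  The formal data from which all three isomorphisms are built: \<open>A t\<close> is \<open>(M t)\<^sup>d\<close> in the
  coordinates \<open>\<theta> t\<close>, and in these coordinates a group element acts by the matrix of its action on
  \<open>I t\<close> applied after its entrywise action on \<open>(M t)\<^sup>d\<close>; likewise for the maps induced by
  morphisms.  The parameter \<open>mapM\<close> says how a morphism \<open>g\<close> acts on \<open>M\<close>; it is the identity for
  points and torsion, and composition with \<open>g\<close> for Tate modules.
\<close>

locale twisted_system =
  fixes R :: "('o, 'r) ring_scheme" and G :: "('g, 'q) monoid_scheme" and T :: "'t set"
    and H :: "'t \<Rightarrow> 't \<Rightarrow> (('i \<Rightarrow> 'i) \<times> 'h) set"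
    and I :: "'t \<Rightarrow> ('o, 'i, 'z) module_scheme" and actI :: "'t \<Rightarrow> 'g \<Rightarrow> 'i \<Rightarrow> 'i"
    and d :: "'t \<Rightarrow> nat" and j :: "'t \<Rightarrow> 'o list \<Rightarrow> 'i"
    and M :: "'t \<Rightarrow> ('o, 'm, 'x) module_scheme" and actM :: "'t \<Rightarrow> 'g \<Rightarrow> 'm \<Rightarrow> 'm"
    and mapM :: "'h \<Rightarrow> 'm \<Rightarrow> 'm"
    and A :: "'t \<Rightarrow> ('o, 'n, 'y) module_scheme" and actA :: "'t \<Rightarrow> 'g \<Rightarrow> 'n \<Rightarrow> 'n"
    and mapA :: "'t \<Rightarrow> 't \<Rightarrow> ('i \<Rightarrow> 'i) \<Rightarrow> 'h \<Rightarrow> 'n \<Rightarrow> 'n"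
    and \<theta> :: "'t \<Rightarrow> 'm list \<Rightarrow> 'n"
  assumes I: "t \<in> T \<Longrightarrow> module R (I t)" and M: "t \<in> T \<Longrightarrow> module R (M t)"
    and A: "t \<in> T \<Longrightarrow> module R (A t)"
    and j: "t \<in> T \<Longrightarrow> j t \<in> linear_isos R (free_module R (d t)) (I t)"
    and \<theta>: "t \<in> T \<Longrightarrow> \<theta> t \<in> linear_isos R (power_module (M t) (d t)) (A t)"
    and actI: "t \<in> T \<Longrightarrow> \<gamma> \<in> carrier G \<Longrightarrow> actI t \<gamma> \<in> linear_maps R (I t) (I t)"
    and actM: "t \<in> T \<Longrightarrow> \<gamma> \<in> carrier G \<Longrightarrow> actM t \<gamma> \<in> linear_maps R (M t) (M t)"
    and mapI: "t \<in> T \<Longrightarrow> t' \<in> T \<Longrightarrow> (f, g) \<in> H t t' \<Longrightarrow> f \<in> linear_maps R (I t) (I t')"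
    and mapM: "t \<in> T \<Longrightarrow> t' \<in> T \<Longrightarrow> (f, g) \<in> H t t' \<Longrightarrow> mapM g \<in> linear_maps R (M t) (M t')"
    and equivariant: "t \<in> T \<Longrightarrow> \<gamma> \<in> carrier G \<Longrightarrow> v \<in> carrier (power_module (M t) (d t)) \<Longrightarrow>
      actA t \<gamma> (\<theta> t v) = \<theta> t (matrix_act R (M t) (d t) (d t)
        (\<lambda>x. inv_into (carrier (free_module R (d t))) (j t) (actI t \<gamma> (j t x))) (map (actM t \<gamma>) v))"
    and natural: "t \<in> T \<Longrightarrow> t' \<in> T \<Longrightarrow> (f, g) \<in> H t t' \<Longrightarrow>
      v \<in> carrier (power_module (M t) (d t)) \<Longrightarrow>
      mapA t t' f g (\<theta> t v) = \<theta> t' (matrix_act R (M t') (d t) (d t')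
        (\<lambda>x. inv_into (carrier (free_module R (d t'))) (j t') (f (j t x))) (map (mapM g) v))"
begin

theorem functorially_isomorphic_tensor:
  "functorially_isomorphic R G T H A actA mapA
     (\<lambda>t. tensor R (I t) (M t))
     (\<lambda>t \<gamma>. tensor_map R (I t) (M t) (actI t \<gamma>) (actM t \<gamma>))
     (\<lambda>t t' f g. tensor_map R (I t') (M t') f (mapM g))"
proof -
  define \<theta>' where "\<theta>' t = inv_into (carrier (power_module (M t) (d t))) (\<theta> t)" for t
  define \<Phi> where "\<Phi> t x = basis_tensor R (I t) (M t) (d t) (j t) (\<theta>' t x)" for t x
  have iso: "\<Phi> t \<in> linear_isos R (A t) (tensor R (I t) (M t))" if t: "t \<in> T" for t
  proof -
    interpret free_module_pair R "I t" "M t" "d t" "j t"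
      using I M j t by (simp add: free_module_pair_def module_pair_def free_module_pair_axioms_def)
    show ?thesis
      unfolding \<Phi>_def[abs_def] \<theta>'_def
      by (rule linear_isos_compose[OF linear_iso_power_inverse[OF M[OF t] \<theta>[OF t]] basis_tensor_iso])
  qed
  have inv: "\<theta>' t x \<in> carrier (power_module (M t) (d t))" "\<theta> t (\<theta>' t x) = x"
    if "t \<in> T" "x \<in> carrier (A t)" for t x
    using linear_isosD(4,5)[OF \<theta>[OF that(1)] that(2)] by (simp_all add: \<theta>'_def)
  have inv': "\<theta>' t (\<theta> t v) = v" if "t \<in> T" "v \<in> carrier (power_module (M t) (d t))" for t v
    using linear_isosD(3)[OF \<theta>[OF that(1)] that(2)] by (simp add: \<theta>'_def)
  have mat: "matrix_act R (M t') (d t) (d t') (\<lambda>x. inv_into (carrier (free_module R (d t'))) (j t') (f (j t x)))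
      (map g v) \<in> carrier (power_module (M t') (d t'))"
    if "t \<in> T" "t' \<in> T" "f \<in> linear_maps R (I t) (I t')" "g \<in> linear_maps R (M t) (M t')"
      "v \<in> carrier (power_module (M t) (d t))" for t t' f g v
    by (rule matrix_act_carrier[OF M[OF that(2)] basis_change_closed[OF j[OF that(1)] j[OF that(2)] that(3)] map_linear[OF that(4,5)]])
  have eq: "\<Phi> t (actA t \<gamma> x) = tensor_map R (I t) (M t) (actI t \<gamma>) (actM t \<gamma>) (\<Phi> t x)"
    if t: "t \<in> T" and \<gamma>: "\<gamma> \<in> carrier G" and x: "x \<in> carrier (A t)" for t \<gamma> x
    using equivariant[OF t \<gamma> inv(1)[OF t x]] inv(2)[OF t x]
      inv'[OF t mat[OF t t actI[OF t \<gamma>] actM[OF t \<gamma>] inv(1)[OF t x]]]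
      basis_tensor_natural[OF I[OF t] M[OF t] I[OF t] M[OF t] j[OF t] j[OF t]
        actI[OF t \<gamma>] actM[OF t \<gamma>] inv(1)[OF t x]]
    by (simp add: \<Phi>_def)
  have nat: "\<Phi> t' (mapA t t' f g x) = tensor_map R (I t') (M t') f (mapM g) (\<Phi> t x)"
    if t: "t \<in> T" "t' \<in> T" and fg: "(f, g) \<in> H t t'" and x: "x \<in> carrier (A t)" for t t' f g x
    using natural[OF t fg inv(1)[OF t(1) x]] inv(2)[OF t(1) x]
      inv'[OF t(2) mat[OF t mapI[OF t fg] mapM[OF t fg] inv(1)[OF t(1) x]]]
      basis_tensor_natural[OF I[OF t(1)] M[OF t(1)] I[OF t(2)] M[OF t(2)] j[OF t(1)] j[OF t(2)]
        mapI[OF t fg] mapM[OF t fg] inv(1)[OF t(1) x]]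
    by (simp add: \<Phi>_def)
  show ?thesis
    unfolding functorially_isomorphic_def using iso eq nat by (intro exI[of _ \<Phi>]) auto
qed

lemma matrix_act_torsion:
  assumes "t \<in> T" "t' \<in> T" "f \<in> linear_maps R (I t) (I t')"
    and v: "v \<in> carrier (power_module (torsion n (M t')) (d t))"
  defines "B \<equiv> \<lambda>x. inv_into (carrier (free_module R (d t'))) (j t') (f (j t x))"
  shows "matrix_act R (torsion n (M t')) (d t) (d t') B v = matrix_act R (M t') (d t) (d t') B v"
  using matrix_act_natural[OF module_torsion M torsion_inclusion basis_change_closed[OF j[OF assms(1)] j[OF assms(2)] assms(3)] v]
    M assms(2) by (simp add: B_def)

lemma matrix_act_tate:
  assumes "t \<in> T" "t' \<in> T" "f \<in> linear_maps R (I t) (I t')"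
    and v: "v \<in> carrier (power_module (tate_module l (M t')) (d t))"
  defines "B \<equiv> \<lambda>x. inv_into (carrier (free_module R (d t'))) (j t') (f (j t x))"
  shows "map (\<lambda>s. s m) (matrix_act R (tate_module l (M t')) (d t) (d t') B v) =
    matrix_act R (M t') (d t) (d t') B (map (\<lambda>s. s m) v)"
  using matrix_act_natural[OF module_tate M tate_evaluation basis_change_closed[OF j[OF assms(1)] j[OF assms(2)] assms(3)] v]
    M assms(2) by (simp add: B_def)

text \<open>
  Restricting every map to torsion keeps all formulas; only the matrix action has to be compared,
  since its sums are now formed in the torsion submodule.
\<close>

lemma torsion_system:
  "twisted_system R G T H I actI d j (\<lambda>t. torsion n (M t)) actM mapM
     (\<lambda>t. torsion n (A t)) actA mapA \<theta>"
proof (rule twisted_system.intro)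
  fix t \<gamma> v assume t: "t \<in> T" "\<gamma> \<in> carrier G" and v: "v \<in> carrier (power_module (torsion n (M t)) (d t))"
  have v': "v \<in> carrier (power_module (M t) (d t))" using v by (auto simp: power_module_def)
  have w: "map (actM t \<gamma>) v \<in> carrier (power_module (torsion n (M t)) (d t))"
    by (rule map_linear[OF torsion_linear[OF M M actM] v]) (use t in auto)
  show "actA t \<gamma> (\<theta> t v) = \<theta> t (matrix_act R (torsion n (M t)) (d t) (d t)
        (\<lambda>x. inv_into (carrier (free_module R (d t))) (j t) (actI t \<gamma> (j t x))) (map (actM t \<gamma>) v))"
    using equivariant[OF t v'] matrix_act_torsion[OF t(1) t(1) actI[OF t] w] by simp
next
  fix t t' f g v assume t: "t \<in> T" "t' \<in> T" "(f, g) \<in> H t t'"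
    and v: "v \<in> carrier (power_module (torsion n (M t)) (d t))"
  have v': "v \<in> carrier (power_module (M t) (d t))" using v by (auto simp: power_module_def)
  have w: "map (mapM g) v \<in> carrier (power_module (torsion n (M t')) (d t))"
    by (rule map_linear[OF torsion_linear[OF M M mapM] v]) (use t in auto)
  show "mapA t t' f g (\<theta> t v) = \<theta> t' (matrix_act R (torsion n (M t')) (d t) (d t')
        (\<lambda>x. inv_into (carrier (free_module R (d t'))) (j t') (f (j t x))) (map (mapM g) v))"
    using natural[OF t v'] matrix_act_torsion[OF t(1,2) mapI[OF t] w] by simp
qed (rule I j actI mapI module_torsion[OF M] module_torsion[OF A] power_iso_torsion[OF M A \<theta>]
    torsion_linear[OF M M actM] torsion_linear[OF M M mapM]; assumption)+

text \<open>
  All formulas hold at each level of the compatible sequences, where they are those for \<open>M\<close>.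
\<close>

lemma tate_system:
  "twisted_system R G T H I actI d j (\<lambda>t. tate_module l (M t)) (\<lambda>t \<gamma> s. actM t \<gamma> \<circ> s)
     (\<lambda>g s. mapM g \<circ> s) (\<lambda>t. tate_module l (A t)) (\<lambda>t \<gamma> s. actA t \<gamma> \<circ> s)
     (\<lambda>t t' f g s. mapA t t' f g \<circ> s) (\<lambda>t v m. \<theta> t (map (\<lambda>s. s m) v))"
proof (rule twisted_system.intro)
  fix t \<gamma> v assume t: "t \<in> T" "\<gamma> \<in> carrier G" and v: "v \<in> carrier (power_module (tate_module l (M t)) (d t))"
  have v': "map (\<lambda>s. s m) v \<in> carrier (power_module (M t) (d t))" for m
    by (rule map_linear[OF tate_evaluation v])
  have w: "map (\<lambda>s. actM t \<gamma> \<circ> s) v \<in> carrier (power_module (tate_module l (M t)) (d t))"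
    by (rule map_linear[OF tate_linear[OF M M actM] v]) (use t in auto)
  show "actA t \<gamma> \<circ> (\<lambda>m. \<theta> t (map (\<lambda>s. s m) v)) =
      (\<lambda>m. \<theta> t (map (\<lambda>s. s m) (matrix_act R (tate_module l (M t)) (d t) (d t)
        (\<lambda>x. inv_into (carrier (free_module R (d t))) (j t) (actI t \<gamma> (j t x)))
        (map (\<lambda>s. actM t \<gamma> \<circ> s) v))))"
    using equivariant[OF t v'] matrix_act_tate[OF t(1) t(1) actI[OF t] w] by (simp add: fun_eq_iff o_def)
next
  fix t t' f g v assume t: "t \<in> T" "t' \<in> T" "(f, g) \<in> H t t'"
    and v: "v \<in> carrier (power_module (tate_module l (M t)) (d t))"
  have v': "map (\<lambda>s. s m) v \<in> carrier (power_module (M t) (d t))" for m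
    by (rule map_linear[OF tate_evaluation v])
  have w: "map (\<lambda>s. mapM g \<circ> s) v \<in> carrier (power_module (tate_module l (M t')) (d t))"
    by (rule map_linear[OF tate_linear[OF M M mapM] v]) (use t in auto)
  show "mapA t t' f g \<circ> (\<lambda>m. \<theta> t (map (\<lambda>s. s m) v)) =
      (\<lambda>m. \<theta> t' (map (\<lambda>s. s m) (matrix_act R (tate_module l (M t')) (d t) (d t')
        (\<lambda>x. inv_into (carrier (free_module R (d t'))) (j t') (f (j t x)))
        (map (\<lambda>s. mapM g \<circ> s) v))))"
    using natural[OF t v'] matrix_act_tate[OF t(1,2) mapI[OF t] w] by (simp add: fun_eq_iff o_def)
qed (rule I j actI mapI module_tate[OF M] module_tate[OF A] power_iso_tate[OF M A \<theta>]
    tate_linear[OF M M actM] tate_linear[OF M M mapM]; assumption)+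

end

section \<open>Galois conjugation of points\<close>

locale galois_setting = \<Omega>: field \<Omega> + ks: subfield ks \<Omega>
  for \<Omega> :: "('a, 'm) ring_scheme" (structure) and k ks :: "'a set" +
  assumes k_ks: "k \<subseteq> ks"
begin

abbreviation "Gal \<equiv> galois_group \<Omega> k ks"

lemma galoisD:
  assumes "\<gamma> \<in> carrier Gal"
  shows "x \<in> ks \<Longrightarrow> \<gamma> x \<in> ks"
    and "x \<in> ks \<Longrightarrow> y \<in> ks \<Longrightarrow> \<gamma> (x \<oplus> y) = \<gamma> x \<oplus> \<gamma> y"
    and "x \<in> ks \<Longrightarrow> y \<in> ks \<Longrightarrow> \<gamma> (x \<otimes> y) = \<gamma> x \<otimes> \<gamma> y"
    and "\<gamma> \<one> = \<one>"
    and "x \<in> k \<Longrightarrow> \<gamma> x = x"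
    and "inj_on \<gamma> ks"
  using assms by (auto simp: galois_group_def Bij_def bij_betw_def ring_hom_def)

lemma ks_carrier: "x \<in> ks \<Longrightarrow> x \<in> carrier \<Omega>"
  using ks.subset by blast

lemmas ks_closed = subringE(2,3,7)[OF subfieldE(1)[OF ks.subfield_axioms]]

lemma galois_zero: "\<gamma> \<in> carrier Gal \<Longrightarrow> \<gamma> \<zero> = \<zero>"
proof -
  assume \<gamma>: "\<gamma> \<in> carrier Gal"
  have "\<zero> \<in> ks" using ks_closed by simp
  then have "\<gamma> \<zero> \<oplus> \<gamma> \<zero> = \<gamma> \<zero>" "\<gamma> \<zero> \<in> carrier \<Omega>"
    using galoisD(2)[OF \<gamma>, of \<zero> \<zero>] galoisD(1)[OF \<gamma>, of \<zero>] ks_carrier by auto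
  then show ?thesis by (simp add: \<Omega>.add.r_cancel_one)
qed

lemma ks_inv: "x \<in> ks \<Longrightarrow> x \<noteq> \<zero> \<Longrightarrow> inv x \<in> ks"
  using \<Omega>.subfield_m_inv(1)[OF ks.subfield_axioms] by simp

lemma galois_inverse:
  assumes \<gamma>: "\<gamma> \<in> carrier Gal" and x: "x \<in> ks" "x \<noteq> \<zero>"
  shows "\<gamma> (inv x) = inv (\<gamma> x)" "\<gamma> x \<noteq> \<zero>"
proof -
  show nz: "\<gamma> x \<noteq> \<zero>"
    using inj_onD[OF galoisD(6)[OF \<gamma>], of x \<zero>] galois_zero[OF \<gamma>] x ks_closed by auto
  have "inv x \<otimes> x = \<one>"
    using \<Omega>.subfield_m_inv(3)[OF ks.subfield_axioms, of x] x by simp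
  then have "\<gamma> (inv x) \<otimes> \<gamma> x = \<one>"
    using galoisD(3)[OF \<gamma> ks_inv[OF x] x(1)] galoisD(4)[OF \<gamma>] by simp
  then show "\<gamma> (inv x) = inv (\<gamma> x)"
    using \<Omega>.comm_inv_char[of "\<gamma> x" "\<gamma> (inv x)"] galoisD(1)[OF \<gamma>] x ks_inv[OF x]
    by (simp add: ks_carrier \<Omega>.m_comm)
qed

text \<open>
  The inverse in \<open>galois_group\<close> is taken in a monoid record whose carrier is a subset of \<open>Bij ks\<close>.
  That it is the inverse bijection rests on this subset being a subgroup.
\<close>

lemma galois_inv_closed:
  assumes \<gamma>: "\<gamma> \<in> carrier Gal"
  shows "inv\<^bsub>Gal\<^esub> \<gamma> \<in> carrier Gal" and "x \<in> ks \<Longrightarrow> (inv\<^bsub>Gal\<^esub> \<gamma>) (\<gamma> x) = x"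
proof -
  let ?B = "BijGroup ks"
  have mult: "\<sigma> \<otimes>\<^bsub>?B\<^esub> \<tau> = compose ks \<sigma> \<tau>" if "\<sigma> \<in> Bij ks" "\<tau> \<in> Bij ks" for \<sigma> \<tau>
    using that by (simp add: BijGroup_def)
  have sub: "subgroup (carrier Gal) ?B"
  proof (rule group.subgroupI[OF group_BijGroup])
    show "carrier Gal \<subseteq> carrier ?B" by (auto simp: galois_group_def BijGroup_def)
    have "(\<lambda>x\<in>ks. x) \<in> carrier Gal"
      using k_ks ks.one_closed ks_closed by (auto simp: galois_group_def id_Bij ring_hom_def)
    then show "carrier Gal \<noteq> {}" by blast
  next
    fix \<sigma> assume \<sigma>: "\<sigma> \<in> carrier Gal"
    then have B: "\<sigma> \<in> Bij ks" by (simp add: galois_group_def)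
    have im: "\<sigma> ` ks = ks" using B by (simp add: Bij_def bij_betw_def)
    let ?i = "inv_into ks \<sigma>"
    have ic: "?i x \<in> ks" "\<sigma> (?i x) = x" if "x \<in> ks" for x
      using that im by (auto simp: inv_into_into f_inv_into_f)
    have iu: "?i x = y" if "y \<in> ks" "\<sigma> y = x" for x y
      using that galoisD(6)[OF \<sigma>] by auto
    have "restrict ?i ks \<in> carrier Gal"
      using restrict_inv_into_Bij[OF B] k_ks ic ks.one_closed ks_closed galoisD[OF \<sigma>]
      by (auto simp: galois_group_def ring_hom_def intro!: iu)
    then show "inv\<^bsub>?B\<^esub> \<sigma> \<in> carrier Gal" by (simp add: inv_BijGroup[OF B])
  next
    fix \<sigma> \<tau> assume \<sigma>: "\<sigma> \<in> carrier Gal" and \<tau>: "\<tau> \<in> carrier Gal"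
    then have B: "\<sigma> \<in> Bij ks" "\<tau> \<in> Bij ks" by (simp_all add: galois_group_def)
    have "compose ks \<sigma> \<tau> \<in> carrier Gal"
      using compose_Bij[OF B] k_ks ks.one_closed ks_closed galoisD[OF \<sigma>] galoisD[OF \<tau>]
      by (auto simp: galois_group_def ring_hom_def compose_def subset_iff)
    then show "\<sigma> \<otimes>\<^bsub>?B\<^esub> \<tau> \<in> carrier Gal" by (simp add: mult[OF B])
  qed
  have eq: "Gal = ?B\<lparr>carrier := carrier Gal\<rparr>" by (simp add: galois_group_def)
  have "inv\<^bsub>Gal\<^esub> \<gamma> = inv\<^bsub>?B\<^esub> \<gamma>"
    using group.m_inv_consistent[OF group_BijGroup sub \<gamma>] eq by simp
  moreover have "\<gamma> \<in> Bij ks" using \<gamma> by (simp add: galois_group_def)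
  ultimately show "inv\<^bsub>Gal\<^esub> \<gamma> \<in> carrier Gal" "x \<in> ks \<Longrightarrow> (inv\<^bsub>Gal\<^esub> \<gamma>) (\<gamma> x) = x"
    using subgroup.m_inv_closed[OF sub \<gamma>] galoisD(1,6)[OF \<gamma>] by (auto simp: inv_BijGroup)
qed

lemma polyfun_value:
  assumes "p \<in> polyfun \<Omega> F n" "F \<subseteq> ks" "length z = n" "set z \<subseteq> ks"
  shows "p z \<in> ks"
  using assms by (induction p) (auto simp: subset_iff ks_closed)

text \<open>
  A field automorphism fixing the coefficients commutes with polynomial evaluation.  This is the
  source of the equivariance of regular maps over \<open>k\<close>.
\<close>

lemma polyfun_galois:
  assumes "p \<in> polyfun \<Omega> k n" "\<gamma> \<in> carrier Gal" "length z = n" "set z \<subseteq> ks"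
  shows "p (map \<gamma> z) = \<gamma> (p z)"
  using assms
proof (induction p)
  case (add p q)
  then show ?case using polyfun_value[OF _ k_ks] by (simp add: galoisD(2))
next
  case (mult p q)
  then show ?case using polyfun_value[OF _ k_ks] by (simp add: galoisD(3))
qed (auto simp: galoisD(5))

text \<open>
  The relation \<open>y = \<gamma> x\<close> for \<open>ks\<close>-rational \<open>x\<close>.  Unlike the function \<open>galois_act\<close>, which is a
  definite description, it can be transported along regular maps, such as the addition map out of
  a power, before existence and uniqueness of \<open>\<gamma> x\<close> are known.
\<close>

definition conjugate_points :: "('v, 'a) chart set \<Rightarrow> ('a \<Rightarrow> 'a) \<Rightarrow> 'v \<Rightarrow> 'v \<Rightarrow> bool" where
  "conjugate_points A \<gamma> x y \<longleftrightarrow> (\<exists>c \<in> A. x \<in> cdom c \<and> y \<in> cdom c \<and>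
     set (coords c x) \<subseteq> ks \<and> coords c y = map \<gamma> (coords c x))"

definition coordinate_atlas :: "('v, 'a) chart set \<Rightarrow> bool" where
  "coordinate_atlas A \<longleftrightarrow> (\<forall>c \<in> A. \<forall>x \<in> cdom c. length (coords c x) = cdim c)"

lemma variety_coordinate_atlas: "variety \<Omega> k A \<Longrightarrow> coordinate_atlas A"
  by (fastforce simp: variety_def coordinate_atlas_def affine_variety_def zariski_closed_def
      affine_space_def)

lemma variety_id: "variety \<Omega> k A \<Longrightarrow> regular_map \<Omega> k A A (\<lambda>x. x)"
  by (simp add: variety_def regular_map_def vimage_def Pi_iff Int_def)

lemma regular_on_value:
  assumes "regular_on \<Omega> F c U h" "F \<subseteq> ks" "x \<in> U"
    and "length (coords c x) = cdim c" "set (coords c x) \<subseteq> ks"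
  shows "h x \<in> ks"
proof -
  obtain p q where pq: "p \<in> polyfun \<Omega> F (cdim c)" "q \<in> polyfun \<Omega> F (cdim c)"
    "q (coords c x) \<noteq> \<zero>" "h x = p (coords c x) \<otimes> inv (q (coords c x))"
    using assms(1,3) unfolding regular_on_def by blast
  then show ?thesis
    using polyfun_value[OF _ assms(2,4,5)] ks_inv by simp
qed

text \<open>
  In coordinates a regular map is locally a quotient of polynomials over \<open>F\<close>, and \<open>ks\<close> is a
  field containing \<open>F\<close>.
\<close>

lemma regular_map_rational:
  assumes f: "regular_map \<Omega> F A B f" and F: "F \<subseteq> ks"
    and "coordinate_atlas A" "coordinate_atlas B" and x: "x \<in> rational_points ks A"
  shows "f x \<in> rational_points ks B"
proof -
  obtain c where c: "c \<in> A" "x \<in> cdom c" "set (coords c x) \<subseteq> ks"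
    using x by (auto simp: rational_points_def)
  then have "f x \<in> atlas_points B"
    using f by (auto simp: regular_map_def atlas_points_def)
  then obtain e where e: "e \<in> B" "f x \<in> cdom e" by (auto simp: atlas_points_def)
  have "coords e (f x) ! i \<in> ks" if "i < cdim e" for i
    using f c e that assms(3) unfolding regular_map_def coordinate_atlas_def
    by (intro regular_on_value[of F c "cdom c \<inter> f -` cdom e" "\<lambda>x. coords e (f x) ! i" x, OF _ F])
      auto
  then have "set (coords e (f x)) \<subseteq> ks"
    using assms(4) e by (auto simp: coordinate_atlas_def set_conv_nth)
  then show ?thesis using e by (auto simp: rational_points_def)
qed

text \<open>
  The preimage of a chart is the locus where one of some polynomials over \<open>k\<close> is nonzero, and
  \<open>\<gamma>\<close> preserves nonvanishing; hence \<open>f y\<close> lies in every chart that contains \<open>f x\<close>.  On this locus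
  the coordinates of \<open>f\<close> are quotients of polynomials over \<open>k\<close>, with which \<open>\<gamma>\<close> commutes.
\<close>

lemma regular_map_conjugate:
  assumes f: "regular_map \<Omega> k A B f"
    and A: "coordinate_atlas A" and B: "coordinate_atlas B"
    and \<gamma>: "\<gamma> \<in> carrier Gal" and xy: "conjugate_points A \<gamma> x y"
    and e: "e \<in> B" "f x \<in> cdom e"
  shows "f y \<in> cdom e" "set (coords e (f x)) \<subseteq> ks" "coords e (f y) = map \<gamma> (coords e (f x))"
proof -
  obtain c where c: "c \<in> A" "x \<in> cdom c" "y \<in> cdom c" "set (coords c x) \<subseteq> ks"
    "coords c y = map \<gamma> (coords c x)"
    using xy by (auto simp: conjugate_points_def)
  let ?U = "cdom c \<inter> f -` cdom e"
  have l: "length (coords c x) = cdim c" using A c by (simp add: coordinate_atlas_def)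
  have x: "x \<in> ?U" using c e by simp
  have reg: "open_in_chart \<Omega> k c ?U" "\<And>i. i < cdim e \<Longrightarrow> regular_on \<Omega> k c ?U (\<lambda>x. coords e (f x) ! i)"
    using f c(1) e(1) by (simp_all add: regular_map_def)
  obtain S where S: "S \<subseteq> polyfun \<Omega> k (cdim c)"
    "?U = {x \<in> cdom c. \<exists>p \<in> S. p (coords c x) \<noteq> \<zero>}"
    using reg(1) unfolding open_in_chart_def by blast
  then obtain p where p: "p \<in> S" "p (coords c x) \<noteq> \<zero>" using x by blast
  have "p (coords c y) = \<gamma> (p (coords c x))"
    using polyfun_galois[OF _ \<gamma> l c(4)] p S c(5) by auto
  moreover have "p (coords c x) \<in> ks" using polyfun_value[OF _ k_ks l c(4)] p S by auto
  ultimately have "p (coords c y) \<noteq> \<zero>" using galois_inverse(2)[OF \<gamma>] p by simp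
  then have y: "y \<in> ?U" using p S c(3) by blast
  then show fy: "f y \<in> cdom e" by simp
  have ks: "coords e (f x) ! i \<in> ks" if "i < cdim e" for i
    by (rule regular_on_value[OF reg(2)[OF that] k_ks x l c(4)])
  have le: "length (coords e (f x)) = cdim e" "length (coords e (f y)) = cdim e"
    using B e fy by (simp_all add: coordinate_atlas_def)
  then show "set (coords e (f x)) \<subseteq> ks"
    using ks by (auto simp: set_conv_nth)
  show "coords e (f y) = map \<gamma> (coords e (f x))"
  proof (rule nth_equalityI)
    fix i assume "i < length (coords e (f y))"
    then have i: "i < cdim e" using le by simp
    then obtain p q where pq: "p \<in> polyfun \<Omega> k (cdim c)" "q \<in> polyfun \<Omega> k (cdim c)"
      "q (coords c x) \<noteq> \<zero>"
      "\<And>z. z \<in> ?U \<Longrightarrow> q (coords c z) \<noteq> \<zero> \<Longrightarrow>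
        coords e (f z) ! i = p (coords c z) \<otimes> inv (q (coords c z))"
      using reg(2)[OF i] x unfolding regular_on_def by blast
    note v = polyfun_value[OF pq(1) k_ks l c(4)] polyfun_value[OF pq(2) k_ks l c(4)]
    have q: "q (coords c y) = \<gamma> (q (coords c x))" and p: "p (coords c y) = \<gamma> (p (coords c x))"
      using polyfun_galois[OF _ \<gamma> l c(4)] pq(1,2) c(5) by auto
    have "q (coords c y) \<noteq> \<zero>" using galois_inverse(2)[OF \<gamma> v(2) pq(3)] q by simp
    then have "coords e (f y) ! i = \<gamma> (p (coords c x)) \<otimes> inv (\<gamma> (q (coords c x)))"
      using pq(4)[OF y] p q by simp
    also have "\<dots> = \<gamma> (coords e (f x) ! i)"
      using pq(4)[OF x pq(3)] galoisD(3)[OF \<gamma> v(1) ks_inv[OF v(2) pq(3)]]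
        galois_inverse(1)[OF \<gamma> v(2) pq(3)] by simp
    finally show "coords e (f y) ! i = map \<gamma> (coords e (f x)) ! i"
      using i le by simp
  qed (use le in simp)
qed

lemma regular_map_conjugate_points:
  assumes "regular_map \<Omega> k A B f" "coordinate_atlas A" "coordinate_atlas B"
    and "\<gamma> \<in> carrier Gal" and xy: "conjugate_points A \<gamma> x y"
  shows "conjugate_points B \<gamma> (f x) (f y)"
proof -
  have "f x \<in> atlas_points B"
    using assms(1) xy by (auto simp: regular_map_def conjugate_points_def atlas_points_def)
  then obtain e where e: "e \<in> B" "f x \<in> cdom e" by (auto simp: atlas_points_def)
  show ?thesis
    using regular_map_conjugate[OF assms e] e unfolding conjugate_points_def by blast
qed

text \<open>
  Existence of \<open>\<gamma> x\<close>: the image of a chart is cut out by polynomials over \<open>k\<close>, so it is stable under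
  \<open>\<gamma>\<close>.  Uniqueness: the identity is a regular map over \<open>k\<close>, so conjugates formed in different
  charts agree by \<open>regular_map_conjugate\<close>.
\<close>

lemma galois_act_conjugate:
  assumes A: "variety \<Omega> k A" and \<gamma>: "\<gamma> \<in> carrier Gal"
  shows "conjugate_points A \<gamma> x y \<longleftrightarrow> x \<in> rational_points ks A \<and> y = galois_act A \<gamma> x"
proof -
  note cA = variety_coordinate_atlas[OF A]
  note any_chart = regular_map_conjugate[OF variety_id[OF A] cA cA \<gamma>]
  have inj: "z = z'" if "c \<in> A" "z \<in> cdom c" "z' \<in> cdom c" "coords c z = coords c z'" for c z z'
    using that A by (auto simp: variety_def inj_on_def)
  have act: "galois_act A \<gamma> x = y" if xy: "conjugate_points A \<gamma> x y" for x y
    unfolding galois_act_def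
  proof (rule the_equality)
    show "\<exists>c\<in>A. x \<in> cdom c \<and> y \<in> cdom c \<and> coords c y = map \<gamma> (coords c x)"
      using xy by (auto simp: conjugate_points_def)
  next
    fix z assume "\<exists>c\<in>A. x \<in> cdom c \<and> z \<in> cdom c \<and> coords c z = map \<gamma> (coords c x)"
    then obtain c where "c \<in> A" "x \<in> cdom c" "z \<in> cdom c" "coords c z = map \<gamma> (coords c x)"
      by blast
    then show "z = y" using any_chart[OF xy] inj by metis
  qed
  have ex: "\<exists>y. conjugate_points A \<gamma> x y" if x: "x \<in> rational_points ks A"
  proof -
    obtain c where c: "c \<in> A" "x \<in> cdom c" "set (coords c x) \<subseteq> ks"
      using x by (auto simp: rational_points_def)
    have l: "length (coords c x) = cdim c" using cA c by (simp add: coordinate_atlas_def)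
    have "zariski_closed \<Omega> k (cdim c) (coords c ` cdom c)"
      using A c(1) by (simp add: variety_def affine_variety_def)
    then obtain S where S: "S \<subseteq> polyfun \<Omega> k (cdim c)"
      "coords c ` cdom c = {z \<in> affine_space \<Omega> (cdim c). \<forall>p \<in> S. p z = \<zero>}"
      unfolding zariski_closed_def by blast
    have "p (map \<gamma> (coords c x)) = \<zero>" if p: "p \<in> S" for p
    proof -
      have "p (coords c x) = \<zero>" using S(2) c(2) p by blast
      then show ?thesis
        using polyfun_galois[OF _ \<gamma> l c(3)] S(1) p galois_zero[OF \<gamma>] by (metis subsetD)
    qed
    moreover have "map \<gamma> (coords c x) \<in> affine_space \<Omega> (cdim c)"
      using c(3) l galoisD(1)[OF \<gamma>] by (auto simp: affine_space_def intro!: ks_carrier)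
    ultimately have "map \<gamma> (coords c x) \<in> coords c ` cdom c" unfolding S(2) by simp
    then show ?thesis using c by (force simp: conjugate_points_def)
  qed
  have "conjugate_points A \<gamma> x y \<Longrightarrow> x \<in> rational_points ks A" for x y
    by (auto simp: conjugate_points_def rational_points_def)
  then show ?thesis
    using act ex by blast
qed

lemma conjugate_points_inverse:
  assumes "\<gamma> \<in> carrier Gal" "conjugate_points A \<gamma> x y"
  shows "conjugate_points A (inv\<^bsub>Gal\<^esub> \<gamma>) y x"
proof -
  obtain c where c: "c \<in> A" "x \<in> cdom c" "y \<in> cdom c" "set (coords c x) \<subseteq> ks"
    "coords c y = map \<gamma> (coords c x)"
    using assms(2) by (auto simp: conjugate_points_def)
  have "map (inv\<^bsub>Gal\<^esub> \<gamma>) (coords c y) = coords c x"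
    using galois_inv_closed(2)[OF assms(1)] c(4) unfolding c(5)
    by (auto simp: map_idI subset_iff)
  moreover have "set (coords c y) \<subseteq> ks" using c(4,5) galoisD(1)[OF assms(1)] by auto
  ultimately show ?thesis using c by (force simp: conjugate_points_def)
qed

lemma galois_act_rational:
  assumes "variety \<Omega> k A" "\<gamma> \<in> carrier Gal" "x \<in> rational_points ks A"
  shows "galois_act A \<gamma> x \<in> rational_points ks A"
    and "galois_act A (inv\<^bsub>Gal\<^esub> \<gamma>) (galois_act A \<gamma> x) = x"
proof -
  have "conjugate_points A \<gamma> x (galois_act A \<gamma> x)"
    using galois_act_conjugate[OF assms(1,2)] assms(3) by blast
  from conjugate_points_inverse[OF assms(2) this]
  show "galois_act A \<gamma> x \<in> rational_points ks A"
    and "galois_act A (inv\<^bsub>Gal\<^esub> \<gamma>) (galois_act A \<gamma> x) = x"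
    using galois_act_conjugate[OF assms(1) galois_inv_closed(1)[OF assms(2)]] by metis+
qed

lemma power_coordinate_atlas: "coordinate_atlas A \<Longrightarrow> coordinate_atlas (power_atlas A d)"
proof -
  assume A: "coordinate_atlas A"
  have "length (concat (map2 coords cs xs)) = sum_list (map cdim cs)"
    if "list_all2 (\<lambda>x c. x \<in> cdom c) xs cs" "set cs \<subseteq> A" for cs and xs :: "'b list"
    using that by induction (use A in \<open>auto simp: coordinate_atlas_def\<close>)
  then show ?thesis
    by (auto simp: coordinate_atlas_def power_atlas_def power_chart_def)
qed

lemma power_rational:
  "rational_points ks (power_atlas A d) = {xs. length xs = d \<and> set xs \<subseteq> rational_points ks A}"
proof (intro equalityI subsetI)
  fix xs assume "xs \<in> rational_points ks (power_atlas A d)"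
  then obtain cs where cs: "length cs = d" "set cs \<subseteq> A" "list_all2 (\<lambda>x c. x \<in> cdom c) xs cs"
    "set (concat (map2 coords cs xs)) \<subseteq> ks"
    by (auto simp: rational_points_def power_atlas_def power_chart_def)
  from cs(3,2,4) have "set xs \<subseteq> rational_points ks A"
    by induction (auto simp: rational_points_def)
  then show "xs \<in> {xs. length xs = d \<and> set xs \<subseteq> rational_points ks A}"
    using cs list_all2_lengthD by auto
next
  fix xs assume "xs \<in> {xs. length xs = d \<and> set xs \<subseteq> rational_points ks A}"
  then have xs: "length xs = d" "set xs \<subseteq> rational_points ks A" by auto
  have "\<exists>cs. set cs \<subseteq> A \<and> list_all2 (\<lambda>x c. x \<in> cdom c) xs cs \<and> set (concat (map2 coords cs xs)) \<subseteq> ks"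
    using xs(2)
  proof (induction xs)
    case Nil
    then show ?case by simp
  next
    case (Cons x xs)
    then obtain cs where "set cs \<subseteq> A" "list_all2 (\<lambda>x c. x \<in> cdom c) xs cs"
      "set (concat (map2 coords cs xs)) \<subseteq> ks" by auto
    moreover obtain c where "c \<in> A" "x \<in> cdom c" "set (coords c x) \<subseteq> ks"
      using Cons by (auto simp: rational_points_def)
    ultimately show ?case by (intro exI[of _ "c # cs"]) auto
  qed
  then obtain cs where cs: "set cs \<subseteq> A" "list_all2 (\<lambda>x c. x \<in> cdom c) xs cs"
    "set (concat (map2 coords cs xs)) \<subseteq> ks" by blast
  then have "power_chart cs \<in> power_atlas A d"
    using list_all2_lengthD[OF cs(2)] xs(1) by (auto simp: power_atlas_def)
  moreover have "xs \<in> cdom (power_chart cs)" "set (coords (power_chart cs) xs) \<subseteq> ks"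
    using cs by (simp_all add: power_chart_def)
  ultimately show "xs \<in> rational_points ks (power_atlas A d)"
    unfolding rational_points_def by blast
qed

lemma power_conjugate_points:
  assumes "list_all2 (conjugate_points A \<gamma>) xs ys"
  shows "conjugate_points (power_atlas A (length xs)) \<gamma> xs ys"
proof -
  have "\<exists>cs. set cs \<subseteq> A \<and> list_all2 (\<lambda>x c. x \<in> cdom c) xs cs \<and> list_all2 (\<lambda>x c. x \<in> cdom c) ys cs \<and>
      set (concat (map2 coords cs xs)) \<subseteq> ks \<and>
      concat (map2 coords cs ys) = map \<gamma> (concat (map2 coords cs xs))"
    using assms
  proof induction
    case Nil
    then show ?case by simp
  next
    case (Cons x xs y ys)
    then obtain cs where "set cs \<subseteq> A" "list_all2 (\<lambda>x c. x \<in> cdom c) xs cs"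
      "list_all2 (\<lambda>x c. x \<in> cdom c) ys cs" "set (concat (map2 coords cs xs)) \<subseteq> ks"
      "concat (map2 coords cs ys) = map \<gamma> (concat (map2 coords cs xs))" by auto
    moreover obtain c where "c \<in> A" "x \<in> cdom c" "y \<in> cdom c" "set (coords c x) \<subseteq> ks"
      "coords c y = map \<gamma> (coords c x)"
      using Cons by (auto simp: conjugate_points_def)
    ultimately show ?case by (intro exI[of _ "c # cs"]) auto
  qed
  then obtain cs where cs: "set cs \<subseteq> A" "list_all2 (\<lambda>x c. x \<in> cdom c) xs cs"
    "list_all2 (\<lambda>x c. x \<in> cdom c) ys cs" "set (concat (map2 coords cs xs)) \<subseteq> ks"
    "concat (map2 coords cs ys) = map \<gamma> (concat (map2 coords cs xs))" by blast
  then have "power_chart cs \<in> power_atlas A (length xs)"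
    using list_all2_lengthD[OF cs(2)] by (auto simp: power_atlas_def)
  then show ?thesis
    unfolding conjugate_points_def
    by (rule bexI[rotated]) (use cs in \<open>simp add: power_chart_def\<close>)
qed

text \<open>
  A chart of the power concatenates coordinate vectors.  The pieces have prescribed lengths, so
  conjugacy of the concatenations splits into conjugacy of the entries.
\<close>

lemma galois_act_power:
  assumes A: "variety \<Omega> k A" and \<gamma>: "\<gamma> \<in> carrier Gal"
    and xs: "length xs = d" "set xs \<subseteq> rational_points ks A"
  shows "galois_act (power_atlas A d) \<gamma> xs = map (galois_act A \<gamma>) xs"
  unfolding galois_act_def[of "power_atlas A d"]
proof (rule the_equality)
  have "conjugate_points A \<gamma> x (galois_act A \<gamma> x)" if "x \<in> set xs" for x
    using galois_act_conjugate[OF A \<gamma>] xs(2) that by blast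
  then have "list_all2 (conjugate_points A \<gamma>) xs (map (galois_act A \<gamma>) xs)"
    by (simp add: list_all2_conv_all_nth)
  from power_conjugate_points[OF this]
  show "\<exists>c\<in>power_atlas A d. xs \<in> cdom c \<and> map (galois_act A \<gamma>) xs \<in> cdom c \<and>
      coords c (map (galois_act A \<gamma>) xs) = map \<gamma> (coords c xs)"
    using xs(1) by (auto simp: conjugate_points_def)
next
  fix ys assume "\<exists>c\<in>power_atlas A d. xs \<in> cdom c \<and> ys \<in> cdom c \<and> coords c ys = map \<gamma> (coords c xs)"
  then obtain cs where cs: "length cs = d" "set cs \<subseteq> A" "list_all2 (\<lambda>x c. x \<in> cdom c) xs cs"
    "list_all2 (\<lambda>x c. x \<in> cdom c) ys cs"
    "concat (map2 coords cs ys) = map \<gamma> (concat (map2 coords cs xs))"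
    by (auto simp: power_atlas_def power_chart_def)
  note cA = variety_coordinate_atlas[OF A]
  note any_chart = regular_map_conjugate[OF variety_id[OF A] cA cA \<gamma>]
  have len: "length (coords c x) = cdim c" if "c \<in> A" "x \<in> cdom c" for c x
    using cA that by (simp add: coordinate_atlas_def)
  from cs(3,2,4,5) xs(2) show "ys = map (galois_act A \<gamma>) xs"
  proof (induction arbitrary: ys)
    case Nil
    then show ?case by simp
  next
    case (Cons x xs c cs)
    then obtain y zs where ys: "ys = y # zs" "y \<in> cdom c" "list_all2 (\<lambda>x c. x \<in> cdom c) zs cs"
      by (auto simp: list_all2_Cons2)
    have c: "c \<in> A" "set cs \<subseteq> A" using Cons by auto
    have "coords c y = map \<gamma> (coords c x) \<and> concat (map2 coords cs zs) = map \<gamma> (concat (map2 coords cs xs))"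
      using Cons.prems(3) len[OF c(1) Cons.hyps(1)] len[OF c(1) ys(2)]
      by (simp add: ys(1))
    moreover have x: "x \<in> rational_points ks A" using Cons by simp
    then have "conjugate_points A \<gamma> x (galois_act A \<gamma> x)"
      using galois_act_conjugate[OF A \<gamma>] by blast
    from any_chart(2)[OF this c(1) Cons.hyps(1)] have "set (coords c x) \<subseteq> ks" .
    ultimately have "conjugate_points A \<gamma> x y"
      using c Cons.hyps ys(2) by (auto simp: conjugate_points_def)
    then have "y = galois_act A \<gamma> x" using galois_act_conjugate[OF A \<gamma>] by blast
    moreover have "zs = map (galois_act A \<gamma>) xs"
      using Cons.IH[OF c(2) ys(3)] Cons.prems(4) \<open>_ \<and> _\<close> by simp
    ultimately show ?case using ys(1) by simp
  qed
qed

end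

section \<open>Rational points of algebraic groups and of their twists\<close>

lemma points_simps [simp]:
  "carrier (points F V) = rational_points F (atlas V)" "add (points F V) = add V"
  "ring.zero (points F V) = ring.zero V" "smult (points F V) = smult V"
  by (simp_all add: points_def)

lemma CAG_power_simps [simp]:
  "carrier (CAG_power V d) = carrier (power_module V d)"
  "add (CAG_power V d) = add (power_module V d)"
  "smult (CAG_power V d) = smult (power_module V d)"
  "atlas (CAG_power V d) = power_atlas (atlas V) d"
  by (simp_all add: CAG_power_def module.defs cag.defs)

lemma CAG_D:
  assumes "V \<in> CAG \<Omega> k R"
  shows "module R V" "variety \<Omega> k (atlas V)" "carrier V = atlas_points (atlas V)"
    and "regular_map \<Omega> k (power_atlas (atlas V) 2) (atlas V) (\<lambda>xs. xs ! 0 \<oplus>\<^bsub>V\<^esub> xs ! 1)"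
    and "regular_map \<Omega> k (atlas V) (atlas V) (\<lambda>x. \<ominus>\<^bsub>V\<^esub> x)"
    and "\<zero>\<^bsub>V\<^esub> \<in> rational_points k (atlas V)"
    and "a \<in> carrier R \<Longrightarrow> regular_map \<Omega> k (atlas V) (atlas V) (\<lambda>x. a \<odot>\<^bsub>V\<^esub> x)"
  using assms by (auto simp: CAG_def)

lemma rational_points_carrier: "V \<in> CAG \<Omega> k R \<Longrightarrow> rational_points F (atlas V) \<subseteq> carrier V"
  by (auto simp: CAG_D(3) rational_points_def atlas_points_def)

lemma points_inclusion: "V \<in> CAG \<Omega> k R \<Longrightarrow> (\<lambda>x. x) \<in> linear_maps R (points F V) V"
  using rational_points_carrier[of V \<Omega> k R F] by (auto simp: linear_maps_def)

context galois_setting begin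

lemma CAG_add_rational:
  assumes V: "V \<in> CAG \<Omega> k R" and x: "x \<in> rational_points ks (atlas V)" "y \<in> rational_points ks (atlas V)"
  shows "x \<oplus>\<^bsub>V\<^esub> y \<in> rational_points ks (atlas V)"
proof -
  note cA = variety_coordinate_atlas[OF CAG_D(2)[OF V]]
  have "[x, y] \<in> rational_points ks (power_atlas (atlas V) 2)"
    using x by (simp add: power_rational)
  from regular_map_rational[OF CAG_D(4)[OF V] k_ks power_coordinate_atlas[OF cA] cA this]
  show ?thesis by simp
qed

text \<open>
  The zero is \<open>k\<close>-rational, and the group operations and scalar multiplications are regular maps
  over \<open>k\<close>, hence preserve \<open>ks\<close>-rational points.
\<close>

lemma module_points:
  assumes V: "V \<in> CAG \<Omega> k R"
  shows "module R (points ks V)"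
proof -
  interpret module R V by (rule CAG_D(1)[OF V])
  note cA = variety_coordinate_atlas[OF CAG_D(2)[OF V]]
  have "submodule (rational_points ks (atlas V)) R V"
  proof (rule submoduleI)
    show "rational_points ks (atlas V) \<subseteq> carrier V" by (rule rational_points_carrier[OF V])
    show "\<zero>\<^bsub>V\<^esub> \<in> rational_points ks (atlas V)"
      using CAG_D(6)[OF V] k_ks by (auto simp: rational_points_def)
  qed (use CAG_add_rational[OF V] regular_map_rational[OF CAG_D(5)[OF V] k_ks cA cA]
      regular_map_rational[OF CAG_D(7)[OF V] k_ks cA cA] in auto)
  from submodule.submodule_is_module[OF this CAG_D(1)[OF V]]
  show ?thesis by (simp add: points_def)
qed

lemma galois_act_linear:
  assumes V: "V \<in> CAG \<Omega> k R" and \<gamma>: "\<gamma> \<in> carrier Gal"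
  shows "galois_act (atlas V) \<gamma> \<in> linear_maps R (points ks V) (points ks V)"
proof -
  note A = CAG_D(2)[OF V] and cA = variety_coordinate_atlas[OF CAG_D(2)[OF V]]
  let ?a = "galois_act (atlas V) \<gamma>"
  note conj = galois_act_conjugate[OF A \<gamma>]
  have "?a (x \<oplus>\<^bsub>V\<^esub> y) = ?a x \<oplus>\<^bsub>V\<^esub> ?a y"
    if "x \<in> rational_points ks (atlas V)" "y \<in> rational_points ks (atlas V)" for x y
  proof -
    have "conjugate_points (power_atlas (atlas V) 2) \<gamma> [x, y] [?a x, ?a y]"
      using power_conjugate_points[of "atlas V" \<gamma> "[x, y]" "[?a x, ?a y]"] conj that
      by (simp add: numeral_2_eq_2)
    from regular_map_conjugate_points[OF CAG_D(4)[OF V] power_coordinate_atlas[OF cA] cA \<gamma> this]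
    show ?thesis by (simp add: conj)
  qed
  moreover have "?a (r \<odot>\<^bsub>V\<^esub> x) = r \<odot>\<^bsub>V\<^esub> ?a x"
    if "r \<in> carrier R" "x \<in> rational_points ks (atlas V)" for r x
  proof -
    have "conjugate_points (atlas V) \<gamma> x (?a x)" using that(2) by (simp add: conj)
    from regular_map_conjugate_points[OF CAG_D(7)[OF V that(1)] cA cA \<gamma> this]
    show ?thesis by (simp add: conj)
  qed
  ultimately show ?thesis
    using galois_act_rational(1)[OF A \<gamma>] by (simp add: linear_maps_def)
qed

lemma CAG_homs_points:
  assumes g: "g \<in> CAG_homs \<Omega> F R V W" and F: "F \<subseteq> ks"
    and V: "coordinate_atlas (atlas V)" and W: "coordinate_atlas (atlas W)"
    and sub: "rational_points ks (atlas V) \<subseteq> carrier V"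
  shows "g \<in> linear_maps R (points ks V) (points ks W)"
proof -
  have "regular_map \<Omega> F (atlas V) (atlas W) g" "g \<in> linear_maps R V W"
    using g by (simp_all add: CAG_homs_def)
  then show ?thesis
    using regular_map_rational[OF _ F V W] sub by (auto simp: linear_maps_def subset_iff)
qed

text \<open>
  Both \<open>\<phi>\<close> and its inverse are defined over \<open>ks\<close> and hence preserve \<open>ks\<close>-rational points; and the
  rational points of a power are the vectors of rational points.
\<close>

lemma twist_iso_points:
  assumes V: "V \<in> CAG \<Omega> k R" and W: "W \<in> CAG \<Omega> k R"
    and \<phi>: "\<phi> \<in> CAG_isos \<Omega> ks R (CAG_power V d) W"
  shows "\<phi> \<in> linear_isos R (power_module (points ks V) d) (points ks W)"
proof -
  let ?P = "CAG_power V d" and ?\<psi> = "inv_into (carrier (CAG_power V d)) \<phi>"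
  note cV = power_coordinate_atlas[OF variety_coordinate_atlas[OF CAG_D(2)[OF V]], of d]
  note cW = variety_coordinate_atlas[OF CAG_D(2)[OF W]]
  have sub: "rational_points ks (atlas ?P) \<subseteq> carrier ?P"
    using rational_points_carrier[OF V, of ks] by (auto simp: power_rational power_module_def)
  have h: "\<phi> \<in> CAG_homs \<Omega> ks R ?P W" "?\<psi> \<in> CAG_homs \<Omega> ks R W ?P"
    and bij: "bij_betw \<phi> (carrier ?P) (carrier W)"
    using \<phi> by (simp_all add: CAG_isos_def)
  have lin: "\<phi> \<in> linear_maps R (points ks ?P) (points ks W)"
    "?\<psi> \<in> linear_maps R (points ks W) (points ks ?P)"
    using CAG_homs_points[OF h(1) order_refl _ cW sub] cV
      CAG_homs_points[OF h(2) order_refl cW _ rational_points_carrier[OF W]] by simp_all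
  have "carrier (points ks W) \<subseteq> \<phi> ` carrier (points ks ?P)"
  proof
    fix w assume w: "w \<in> carrier (points ks W)"
    then have "\<phi> (?\<psi> w) = w"
      using bij rational_points_carrier[OF W, of ks]
      by (intro bij_betw_inv_into_right[OF bij]) auto
    then show "w \<in> \<phi> ` carrier (points ks ?P)"
      using linear_mapsD(1)[OF lin(2) w] by (metis image_eqI)
  qed
  then have "bij_betw \<phi> (carrier (points ks ?P)) (carrier (points ks W))"
    using linear_mapsD(1)[OF lin(1)] bij sub
    by (auto simp: bij_betw_def intro: inj_on_subset)
  moreover have "carrier (points ks ?P) = carrier (power_module (points ks V) d)"
    "add (points ks ?P) = add (power_module (points ks V) d)"
    "smult (points ks ?P) = smult (power_module (points ks V) d)"
    by (simp_all add: power_rational power_module_def)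
  ultimately show ?thesis
    using lin(1) by (simp add: linear_isos_def linear_maps_def)
qed

end

lemma FMod_D:
  assumes "I \<in> FMod \<Omega> k ks R"
  shows "module R I" "k \<subseteq> ks"
    and "\<gamma> \<in> carrier (galois_group \<Omega> k ks) \<Longrightarrow> (\<lambda>x. ract I x \<gamma>) \<in> linear_maps R I I"
proof -
  show "module R I" and "\<gamma> \<in> carrier (galois_group \<Omega> k ks) \<Longrightarrow> (\<lambda>x. ract I x \<gamma>) \<in> linear_maps R I I"
    using assms by (simp_all add: FMod_def Let_def)
  have "\<exists>L. k \<subseteq> L \<and> L \<subseteq> ks"
    using assms unfolding FMod_def Let_def mem_Collect_eq by (elim conjE exE) (rule exI, rule conjI)
  then show "k \<subseteq> ks" by blast
qed

lemma twistsD: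
  assumes "T = twists \<Omega> k ks R" "t \<in> T"
  shows "tw_I t \<in> FMod \<Omega> k ks R" "tw_V t \<in> CAG \<Omega> k R" "tw_obj t \<in> CAG \<Omega> k R"
    and "tw_basis t \<in> linear_isos R (free_module R (tw_rank t)) (tw_I t)"
    and "tw_iso t \<in> CAG_isos \<Omega> ks R (CAG_power (tw_V t) (tw_rank t)) (tw_obj t)"
    and "\<gamma> \<in> carrier (galois_group \<Omega> k ks) \<Longrightarrow>
      v \<in> carrier (points ks (CAG_power (tw_V t) (tw_rank t))) \<Longrightarrow>
      twist_cocycle \<Omega> k ks R t \<gamma> v = inv_into (carrier (CAG_power (tw_V t) (tw_rank t))) (tw_iso t)
        (conjugate_map \<Omega> k ks (CAG_power (tw_V t) (tw_rank t)) (tw_obj t) \<gamma> (tw_iso t) v)"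
  using assms by (simp_all add: twists_def Let_def)

text \<open>
  The cocycle relation, evaluated at \<open>\<gamma> v\<close> and with \<open>\<phi>\<close> applied to both sides, reads
  \<open>\<phi> (c(\<gamma>) (\<gamma> v)) = \<gamma> (\<phi> v)\<close>, which is the equivariance required of a twisted system.  The naturality
  required is the definition of \<open>f \<otimes> g\<close> on twists.
\<close>

lemma points_system:
  fixes \<Omega> :: "('a, 'm) ring_scheme" and R :: "('o, 'r) ring_scheme"
    and T :: "('o, 'i, 'v, 'w, 'a) twist set"
  assumes "field \<Omega>" "subfield ks \<Omega>" and T: "T = twists \<Omega> k ks R"
  shows "twisted_system R (galois_group \<Omega> k ks) T (twist_homs \<Omega> k ks R) tw_I
    (\<lambda>t \<gamma> x. ract (tw_I t) x (inv\<^bsub>galois_group \<Omega> k ks\<^esub> \<gamma>)) tw_rank tw_basis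
    (\<lambda>t. points ks (tw_V t)) (\<lambda>t \<gamma>. galois_act (atlas (tw_V t)) \<gamma>) (\<lambda>g. g)
    (\<lambda>t. points ks (tw_obj t)) (\<lambda>t \<gamma>. galois_act (atlas (tw_obj t)) \<gamma>)
    (\<lambda>t t' f g. twist_map R t t' f g) tw_iso"
proof (cases "T = {}")
  case True
  then show ?thesis by (simp add: twisted_system_def)
next
  case False
  \<comment> \<open>the finite extension \<open>L\<close> through which the Galois action on some \<open>I\<close> factors lies between \<open>k\<close> and \<open>ks\<close>\<close>
  then have "k \<subseteq> ks" using FMod_D(2)[OF twistsD(1)[OF T]] by blast
  then interpret galois_setting \<Omega> k ks
    using assms by (simp add: galois_setting_def galois_setting_axioms_def)
  note D = twistsD[OF T]
  have iso: "tw_iso t \<in> linear_isos R (power_module (points ks (tw_V t)) (tw_rank t)) (points ks (tw_obj t))"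
    if "t \<in> T" for t
    by (rule twist_iso_points[OF D(2,3,5)[OF that]])
  have actI: "(\<lambda>x. ract (tw_I t) x (inv\<^bsub>Gal\<^esub> \<gamma>)) \<in> linear_maps R (tw_I t) (tw_I t)"
    if "t \<in> T" "\<gamma> \<in> carrier Gal" for t \<gamma>
    by (rule FMod_D(3)[OF D(1)[OF that(1)] galois_inv_closed(1)[OF that(2)]])
  have mapM: "g \<in> linear_maps R (points ks (tw_V t)) (points ks (tw_V t'))"
    if "t \<in> T" "t' \<in> T" "g \<in> CAG_homs \<Omega> k R (tw_V t) (tw_V t')" for t t' g
    by (rule CAG_homs_points[OF that(3) k_ks])
      (use that D(2) CAG_D(2) rational_points_carrier in \<open>blast intro: variety_coordinate_atlas\<close>)+
  have homs: "f \<in> linear_maps R (tw_I t) (tw_I t')"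
    "g \<in> linear_maps R (points ks (tw_V t)) (points ks (tw_V t'))"
    if "t \<in> T" "t' \<in> T" "(f, g) \<in> twist_homs \<Omega> k ks R t t'" for t t' f g
    using that mapM[OF that(1,2)] by (auto simp: twist_homs_def FMod_homs_def)
  have mat: "matrix_act R (points ks (tw_V t')) (tw_rank t) (tw_rank t')
        (\<lambda>x. inv_into (carrier (free_module R (tw_rank t'))) (tw_basis t') (f (tw_basis t x))) v =
      matrix_act R (tw_V t') (tw_rank t) (tw_rank t')
        (\<lambda>x. inv_into (carrier (free_module R (tw_rank t'))) (tw_basis t') (f (tw_basis t x))) v"
    if "t \<in> T" "t' \<in> T" "f \<in> linear_maps R (tw_I t) (tw_I t')"
      "v \<in> carrier (power_module (points ks (tw_V t')) (tw_rank t))" for t t' f v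
    using matrix_act_natural[OF module_points[OF D(2)[OF that(2)]] CAG_D(1)[OF D(2)[OF that(2)]]
        points_inclusion[OF D(2)[OF that(2)]] basis_change_closed[OF D(4)[OF that(1)] D(4)[OF that(2)] that(3)] that(4)] by simp
  have rat: "carrier (power_module (points ks V) d) = rational_points ks (power_atlas (atlas V) d)"
    for V :: "('o, 'v, 'a) cag" and d
    by (simp add: power_rational power_module_def)
  have sub: "carrier (power_module (points ks V) d) \<subseteq> carrier (power_module V d)"
    if "V \<in> CAG \<Omega> k R" for V :: "('o, 'v, 'a) cag" and d
    using rational_points_carrier[OF that, of ks] by (auto simp: power_module_def)
  show ?thesis
  proof (rule twisted_system.intro)
    fix t \<gamma> v assume t: "t \<in> T" and \<gamma>: "\<gamma> \<in> carrier Gal"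
      and v: "v \<in> carrier (power_module (points ks (tw_V t)) (tw_rank t))"
    let ?P = "CAG_power (tw_V t) (tw_rank t)" and ?a = "galois_act (atlas (tw_V t))"
    let ?y = "galois_act (atlas (tw_obj t)) \<gamma> (tw_iso t v)"
    note A = CAG_D(2)[OF D(2)[OF t]]
    have vr: "length v = tw_rank t" "set v \<subseteq> rational_points ks (atlas (tw_V t))"
      using v by (auto simp: power_module_def)
    have u: "map (?a \<gamma>) v \<in> carrier (power_module (points ks (tw_V t)) (tw_rank t))"
      by (rule map_linear[OF galois_act_linear[OF D(2)[OF t] \<gamma>] v])
    have "galois_act (atlas ?P) (inv\<^bsub>Gal\<^esub> \<gamma>) (map (?a \<gamma>) v) = map (?a (inv\<^bsub>Gal\<^esub> \<gamma>)) (map (?a \<gamma>) v)"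
      using galois_act_power[OF A galois_inv_closed(1)[OF \<gamma>], of "map (?a \<gamma>) v" "tw_rank t"] u
      by (simp add: power_module_def)
    also have "\<dots> = v"
      using galois_act_rational(2)[OF A \<gamma>] vr(2) by (auto simp: map_idI subset_iff)
    finally have "conjugate_map \<Omega> k ks ?P (tw_obj t) \<gamma> (tw_iso t) (map (?a \<gamma>) v) = ?y"
      by (simp add: conjugate_map_def)
    then have c: "twist_cocycle \<Omega> k ks R t \<gamma> (map (?a \<gamma>) v) = inv_into (carrier ?P) (tw_iso t) ?y"
      using D(6)[OF t \<gamma>, of "map (?a \<gamma>) v"] u by (simp add: rat)
    have "tw_iso t v \<in> rational_points ks (atlas (tw_obj t))"
      using linear_mapsD(1)[OF linear_isosD(1)[OF iso[OF t]] v] by simp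
    then have "?y \<in> carrier (tw_obj t)"
      using galois_act_rational(1)[OF CAG_D(2)[OF D(3)[OF t]] \<gamma>] rational_points_carrier[OF D(3)[OF t]]
      by blast
    moreover have "bij_betw (tw_iso t) (carrier ?P) (carrier (tw_obj t))"
      using D(5)[OF t] by (simp add: CAG_isos_def)
    ultimately have "tw_iso t (inv_into (carrier ?P) (tw_iso t) ?y) = ?y"
      by (simp only: bij_betw_inv_into_right)
    then have "?y = tw_iso t (twist_cocycle \<Omega> k ks R t \<gamma> (map (?a \<gamma>) v))" by (simp only: c)
    then show "?y = tw_iso t (matrix_act R (points ks (tw_V t)) (tw_rank t) (tw_rank t)
        (\<lambda>x. inv_into (carrier (free_module R (tw_rank t))) (tw_basis t)
          (ract (tw_I t) (tw_basis t x) (inv\<^bsub>Gal\<^esub> \<gamma>))) (map (?a \<gamma>) v))"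
      using mat[OF t t actI[OF t \<gamma>] u]
      by (simp add: twist_cocycle_def basis_cocycle_def[abs_def])
  next
    fix t t' f g v assume t: "t \<in> T" "t' \<in> T" and fg: "(f, g) \<in> twist_homs \<Omega> k ks R t t'"
      and v: "v \<in> carrier (power_module (points ks (tw_V t)) (tw_rank t))"
    note f = homs(1)[OF t fg] and g = homs(2)[OF t fg]
    have "bij_betw (tw_iso t) (carrier (CAG_power (tw_V t) (tw_rank t))) (carrier (tw_obj t))"
      using D(5)[OF t(1)] by (simp add: CAG_isos_def)
    then have "inv_into (carrier (CAG_power (tw_V t) (tw_rank t))) (tw_iso t) (tw_iso t v) = v"
      using sub[OF D(2)[OF t(1)]] v by (intro bij_betw_inv_into_left) auto
    then show "twist_map R t t' f g (tw_iso t v) =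
        tw_iso t' (matrix_act R (points ks (tw_V t')) (tw_rank t) (tw_rank t')
          (\<lambda>x. inv_into (carrier (free_module R (tw_rank t'))) (tw_basis t') (f (tw_basis t x))) (map g v))"
      using mat[OF t f map_linear[OF g v]] by (simp add: twist_map_def)
  qed (rule FMod_D(1)[OF D(1)] module_points[OF D(2)] module_points[OF D(3)] D(4) iso actI
      galois_act_linear[OF D(2)] homs; assumption)+
qed

theorem theorem2p2:
  fixes \<Omega> :: "('a, 'm) ring_scheme" and k ks :: "'a set"
    and R :: "('o, 'r) ring_scheme"
    and n l :: nat
    and T :: "('o, 'i, 'v, 'w, 'a) twist set"
  assumes "algebraic_closure \<Omega> k"
    and "separable_closure \<Omega> k ks"
    and "cring R"
    and "n > 0"
    and "prime l"
    and "T = twists \<Omega> k ks R"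
  shows
    "functorially_isomorphic R (galois_group \<Omega> k ks) T (twist_homs \<Omega> k ks R)
       (\<lambda>t. points ks (tw_obj t))
       (\<lambda>t \<gamma>. galois_act (atlas (tw_obj t)) \<gamma>)
       (\<lambda>t t' f g. twist_map R t t' f g)
       (\<lambda>t. tensor R (tw_I t) (points ks (tw_V t)))
       (\<lambda>t \<gamma>. tensor_map R (tw_I t) (points ks (tw_V t))
          (\<lambda>x. ract (tw_I t) x (inv\<^bsub>galois_group \<Omega> k ks\<^esub> \<gamma>)) (galois_act (atlas (tw_V t)) \<gamma>))
       (\<lambda>t t' f g. tensor_map R (tw_I t') (points ks (tw_V t')) f g) \<and>
     functorially_isomorphic R (galois_group \<Omega> k ks) T (twist_homs \<Omega> k ks R)
       (\<lambda>t. torsion n (points ks (tw_obj t)))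
       (\<lambda>t \<gamma>. galois_act (atlas (tw_obj t)) \<gamma>)
       (\<lambda>t t' f g. twist_map R t t' f g)
       (\<lambda>t. tensor R (tw_I t) (torsion n (points ks (tw_V t))))
       (\<lambda>t \<gamma>. tensor_map R (tw_I t) (torsion n (points ks (tw_V t)))
          (\<lambda>x. ract (tw_I t) x (inv\<^bsub>galois_group \<Omega> k ks\<^esub> \<gamma>)) (galois_act (atlas (tw_V t)) \<gamma>))
       (\<lambda>t t' f g. tensor_map R (tw_I t') (torsion n (points ks (tw_V t'))) f g) \<and>
     functorially_isomorphic R (galois_group \<Omega> k ks) T (twist_homs \<Omega> k ks R)
       (\<lambda>t. tate_module l (points ks (tw_obj t)))
       (\<lambda>t \<gamma> s. galois_act (atlas (tw_obj t)) \<gamma> \<circ> s)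
       (\<lambda>t t' f g s. twist_map R t t' f g \<circ> s)
       (\<lambda>t. tensor R (tw_I t) (tate_module l (points ks (tw_V t))))
       (\<lambda>t \<gamma>. tensor_map R (tw_I t) (tate_module l (points ks (tw_V t)))
          (\<lambda>x. ract (tw_I t) x (inv\<^bsub>galois_group \<Omega> k ks\<^esub> \<gamma>)) (\<lambda>s. galois_act (atlas (tw_V t)) \<gamma> \<circ> s))
       (\<lambda>t t' f g. tensor_map R (tw_I t') (tate_module l (points ks (tw_V t'))) f (\<lambda>s. g \<circ> s))"
proof -
  have "field \<Omega>" "subfield ks \<Omega>"
    using assms(1,2) by (auto simp: algebraic_closure_def separable_closure_def)
  then interpret points: twisted_system R "galois_group \<Omega> k ks" T "twist_homs \<Omega> k ks R" tw_I
    "\<lambda>t \<gamma> x. ract (tw_I t) x (inv\<^bsub>galois_group \<Omega> k ks\<^esub> \<gamma>)" tw_rank tw_basis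
    "\<lambda>t. points ks (tw_V t)" "\<lambda>t \<gamma>. galois_act (atlas (tw_V t)) \<gamma>" "\<lambda>g. g"
    "\<lambda>t. points ks (tw_obj t)" "\<lambda>t \<gamma>. galois_act (atlas (tw_obj t)) \<gamma>"
    "\<lambda>t t' f g. twist_map R t t' f g" tw_iso
    using assms(6) by (rule points_system)
  show ?thesis
    by (intro conjI points.functorially_isomorphic_tensor
        twisted_system.functorially_isomorphic_tensor[OF points.torsion_system]
        twisted_system.functorially_isomorphic_tensor[OF points.tate_system])
qed

end
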